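(* Let $G$ be an SE-graph with sources $r_1,\dots,r_m$ and sinks $c_1,\dots,c_n$, and let $\mathrm{Path}_G$ be its path matrix. Then for every $(I|J)\in\mathcal E^{m,n}$, $$[I|J]_{\mathrm{Path}_G,q}=\sum_{\phi\in\Phi(I|J)} w(\phi),$$ where $\Phi(I|J)$ is the set of $(I|J)$-flows in $G$.
   Context: Notation: $[p]=\{1,\dots,p\}$; $\mathcal E^{m,n}$ is the set of pairs $(I|J)$ with $I\subseteq[m]$, $J\subseteq[n]$, $|I|=|J|$. Fix a field $\mathbb K$ and $q\in\mathbb K^\ast$. An SE-graph is a finite directed graph $G=(V,E)$ embedded in the plane (planar with a fixed layout) such that: every edge is either a horizontal edge (H-edge) directed to the right or a vertical edge (V-edge) directed downward; there are distinguished vertices $r_1,\dots,r_m$ (sources) lying on a vertical line in this order upward, and $c_1,\dots,c_n$ (sinks) lying on a horizontal line in this order from left to right; sources are incident only with H-edges and sinks only with V-edges; every vertex lies on a directed path from a source to a sink. Let $W$ be the set of inner vertices (neither sources nor sinks). $\mathcal L_G$ is the $\mathbb K$-algebra of Laurent polynomials in the elements of $W$ with relations, for distinct $u,v\in W$: $uv=qvu$ if $G$ has a directed horizontal path from $u$ to $v$; $vu=quv$ if $G$ has a directed vertical path from $u$ to $v$; $uv=vu$ otherwise. Edge weights: $w(e)=v$ if $e=(u,v)$ with $u$ a source; $w(e)=u^{-1}v$ if $e=(u,v)$ is an H-edge with $u,v\in W$; $w(e)=1$ for V-edges. The weight of a directed path $e_1\cdots e_k$ is $w(e_1)\cdots w(e_k)$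 (ordered product). $\mathrm{Path}_G$ is the $m\times n$ matrix whose $(i,j)$ entry is the sum of weights of directed paths from $r_i$ to $c_j$. For $(I|J)\in\mathcal E^{m,n}$, an $(I|J)$-flow is a set of pairwise vertex-disjoint directed paths from the sources $\{r_i:i\in I\}$ to the sinks $\{c_j:j\in J\}$ (one path starting at each such source). Writing $I=\{i_1<\dots<i_k\}$, $J=\{j_1<\dots<j_k\}$, the $\ell$-th path $P_\ell$ of the flow starts at $r_{i_\ell}$ (and ends at $c_{j_\ell}$), and the weight of the flow $\phi=(P_1,\dots,P_k)$ is the ordered product $w(\phi)=w(P_1)\cdots w(P_k)$. The $q$-minor of a matrix $A=(a_{ij})$ is $[I|J]_{A,q}=\sum_{\sigma\in S_k}(-q)^{\ell(\sigma)}a_{i_1j_{\sigma(1)}}\cdots a_{i_kj_{\sigma(k)}}$ (product ordered left to right), with $\ell(\sigma)$ the number of inversions. *)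

theory Defs
  imports "HOL-Analysis.Analysis" "HOL-Combinatorics.Permutations"
begin

type_synonym point = "real \<times> real"

definition is_H :: "('v \<Rightarrow> point) \<Rightarrow> 'v \<Rightarrow> 'v \<Rightarrow> bool" where
  "is_H pos u v \<longleftrightarrow> snd (pos u) = snd (pos v) \<and> fst (pos u) < fst (pos v)"

definition is_V :: "('v \<Rightarrow> point) \<Rightarrow> 'v \<Rightarrow> 'v \<Rightarrow> bool" where
  "is_V pos u v \<longleftrightarrow> fst (pos u) = fst (pos v) \<and> snd (pos v) < snd (pos u)"

definition edge_seg :: "('v \<Rightarrow> point) \<Rightarrow> 'v \<times> 'v \<Rightarrow> point set" where
  "edge_seg pos e = closed_segment (pos (fst e)) (pos (snd e))"

definition is_path :: "('v \<times> 'v) set \<Rightarrow> 'v list \<Rightarrow> 'v \<Rightarrow> 'v \<Rightarrow> bool" where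
  "is_path E p u v \<longleftrightarrow> p \<noteq> [] \<and> hd p = u \<and> last p = v \<and>
     (\<forall>k < length p - 1. (p ! k, p ! Suc k) \<in> E)"

definition hpath :: "('v \<times> 'v) set \<Rightarrow> ('v \<Rightarrow> point) \<Rightarrow> 'v \<Rightarrow> 'v \<Rightarrow> bool" where
  "hpath E pos u v \<longleftrightarrow> (\<exists>p. is_path E p u v \<and> length p \<ge> 2 \<and>
     (\<forall>k < length p - 1. is_H pos (p ! k) (p ! Suc k)))"

definition vpath :: "('v \<times> 'v) set \<Rightarrow> ('v \<Rightarrow> point) \<Rightarrow> 'v \<Rightarrow> 'v \<Rightarrow> bool" where
  "vpath E pos u v \<longleftrightarrow> (\<exists>p. is_path E p u v \<and> length p \<ge> 2 \<and>
     (\<forall>k < length p - 1. is_V pos (p ! k) (p ! Suc k)))"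

definition se_graph ::
  "'v set \<Rightarrow> ('v \<times> 'v) set \<Rightarrow> ('v \<Rightarrow> point) \<Rightarrow> nat \<Rightarrow> nat \<Rightarrow> (nat \<Rightarrow> 'v) \<Rightarrow> (nat \<Rightarrow> 'v) \<Rightarrow> bool"
where
  "se_graph V E pos m n r c \<longleftrightarrow>
     finite V \<and> E \<subseteq> V \<times> V \<and> inj_on pos V \<and>
     \<comment> \<open>every edge is an H-edge (to the right) or a V-edge (downward)\<close>
     (\<forall>(u,v)\<in>E. is_H pos u v \<or> is_V pos u v) \<and>
     \<comment> \<open>planarity of the straight-line embedding\<close>
     (\<forall>e\<in>E. \<forall>e'\<in>E. e \<noteq> e' \<longrightarrow>
        edge_seg pos e \<inter> edge_seg pos e' \<subseteq> pos ` ({fst e, snd e} \<inter> {fst e', snd e'})) \<and>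
     (\<forall>w\<in>V. \<forall>e\<in>E. pos w \<in> edge_seg pos e \<longrightarrow> w = fst e \<or> w = snd e) \<and>
     \<comment> \<open>sources and sinks\<close>
     r ` {1..m} \<subseteq> V \<and> c ` {1..n} \<subseteq> V \<and>
     inj_on r {1..m} \<and> inj_on c {1..n} \<and> r ` {1..m} \<inter> c ` {1..n} = {} \<and>
     (\<forall>i\<in>{1..m}. \<forall>i'\<in>{1..m}. fst (pos (r i)) = fst (pos (r i'))) \<and>
     (\<forall>i\<in>{1..m}. \<forall>i'\<in>{1..m}. i < i' \<longrightarrow> snd (pos (r i)) < snd (pos (r i'))) \<and>
     (\<forall>j\<in>{1..n}. \<forall>j'\<in>{1..n}. snd (pos (c j)) = snd (pos (c j'))) \<and>
     (\<forall>j\<in>{1..n}. \<forall>j'\<in>{1..n}. j < j' \<longrightarrow> fst (pos (c j)) < fst (pos (c j'))) \<and>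
     (\<forall>(u,v)\<in>E. (u \<in> r ` {1..m} \<or> v \<in> r ` {1..m}) \<longrightarrow> is_H pos u v) \<and>
     (\<forall>(u,v)\<in>E. (u \<in> c ` {1..n} \<or> v \<in> c ` {1..n}) \<longrightarrow> is_V pos u v) \<and>
     \<comment> \<open>every vertex lies on a directed path from a source to a sink\<close>
     (\<forall>w\<in>V. \<exists>i\<in>{1..m}. \<exists>j\<in>{1..n}. \<exists>p. is_path E p (r i) (c j) \<and> w \<in> set p)"

definition inner_vertices ::
  "'v set \<Rightarrow> nat \<Rightarrow> nat \<Rightarrow> (nat \<Rightarrow> 'v) \<Rightarrow> (nat \<Rightarrow> 'v) \<Rightarrow> 'v set" where
  "inner_vertices V m n r c = V - r ` {1..m} - c ` {1..n}"

section \<open>Weights (in a K-algebra, images x w of the generators w of L_G, inverses xinv w)\<close>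

definition edge_weight ::
  "('v \<Rightarrow> point) \<Rightarrow> nat \<Rightarrow> (nat \<Rightarrow> 'v) \<Rightarrow> ('v \<Rightarrow> 'a::ring_1) \<Rightarrow> ('v \<Rightarrow> 'a) \<Rightarrow> 'v \<Rightarrow> 'v \<Rightarrow> 'a" where
  "edge_weight pos m r x xinv u v =
     (if u \<in> r ` {1..m} then x v
      else if is_H pos u v then xinv u * x v
      else 1)"

definition path_weight ::
  "('v \<Rightarrow> point) \<Rightarrow> nat \<Rightarrow> (nat \<Rightarrow> 'v) \<Rightarrow> ('v \<Rightarrow> 'a::ring_1) \<Rightarrow> ('v \<Rightarrow> 'a) \<Rightarrow> 'v list \<Rightarrow> 'a" where
  "path_weight pos m r x xinv p =
     prod_list (map (\<lambda>k. edge_weight pos m r x xinv (p ! k) (p ! Suc k)) [0..<length p - 1])"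

definition path_matrix ::
  "('v \<times> 'v) set \<Rightarrow> ('v \<Rightarrow> point) \<Rightarrow> nat \<Rightarrow> (nat \<Rightarrow> 'v) \<Rightarrow> (nat \<Rightarrow> 'v) \<Rightarrow>
   ('v \<Rightarrow> 'a::ring_1) \<Rightarrow> ('v \<Rightarrow> 'a) \<Rightarrow> nat \<Rightarrow> nat \<Rightarrow> 'a" where
  "path_matrix E pos m r c x xinv i j =
     (\<Sum>p\<in>{p. is_path E p (r i) (c j)}. path_weight pos m r x xinv p)"

definition inversions :: "(nat \<Rightarrow> nat) \<Rightarrow> nat \<Rightarrow> nat" where
  "inversions \<sigma> k = card {(a, b). a < b \<and> b < k \<and> \<sigma> b < \<sigma> a}"

text \<open>q-minor [I|J] of A (rows/columns indexed by naturals); emb is the structure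
  map of the K-algebra.\<close>
definition qminor ::
  "('k::field \<Rightarrow> 'a::ring_1) \<Rightarrow> 'k \<Rightarrow> (nat \<Rightarrow> nat \<Rightarrow> 'a) \<Rightarrow> nat set \<Rightarrow> nat set \<Rightarrow> 'a" where
  "qminor emb q A I J =
     (let il = sorted_list_of_set I; jl = sorted_list_of_set J; k = card I in
      \<Sum>\<sigma>\<in>{\<sigma>. \<sigma> permutes {..<k}}.
        emb ((- q) ^ inversions \<sigma> k) * prod_list (map (\<lambda>t. A (il ! t) (jl ! \<sigma> t)) [0..<k]))"

definition flows ::
  "('v \<times> 'v) set \<Rightarrow> (nat \<Rightarrow> 'v) \<Rightarrow> (nat \<Rightarrow> 'v) \<Rightarrow> nat set \<Rightarrow> nat set \<Rightarrow> 'v list list set" where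
  "flows E r c I J =
     {P. length P = card I \<and>
         (\<forall>l < card I. \<exists>j\<in>J. is_path E (P ! l) (r (sorted_list_of_set I ! l)) (c j)) \<and>
         (\<forall>l < card I. \<forall>l' < card I. l \<noteq> l' \<longrightarrow> set (P ! l) \<inter> set (P ! l') = {})}"

definition flow_weight ::
  "('v \<Rightarrow> point) \<Rightarrow> nat \<Rightarrow> (nat \<Rightarrow> 'v) \<Rightarrow> ('v \<Rightarrow> 'a::ring_1) \<Rightarrow> ('v \<Rightarrow> 'a) \<Rightarrow> 'v list list \<Rightarrow> 'a" where
  "flow_weight pos m r x xinv P = prod_list (map (path_weight pos m r x xinv) P)"

end

theory Submission
  imports Defs
begin

text \<open>
  Expanding the minor gives a signed sum over all systems of paths; the systems whose paths meet
  cancel in pairs. Let \<open>v\<close> be a shared vertex with \<open>x - y\<close> maximal. Exactly two paths pass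
  through \<open>v\<close>; one leaves it vertically, the other horizontally, their tails do not meet again, and by
  planarity the vertical tail ends at a sink directly preceding, among the sinks in use, that of
  the horizontal one. Exchanging the tails therefore changes the number of inversions by one, and
  it multiplies the weight by \<open>q\<close> or its inverse.

  The exponent is computed from the skew form \<open>form\<close> describing the commutation of the generators.
  The tail \<open>A\<close> from \<open>v\<close> to a sink \<open>s\<close> pairs with an inner vertex \<open>w\<close> to
  \<open>above s w - vform v w - 2 [w \<in> A] + [w = v]\<close>. In the difference of two tails from \<open>v\<close> the terms
  depending on \<open>v\<close> cancel, and summing what is left along a path from a source to a sink gives \<open>0\<close>
  if the path avoids both tails and \<open>1\<close> if it contains the horizontal one.
\<close>

section \<open>Sums over the horizontal edges of a path\<close>

text \<open>In a commutative ring any canonical common vertex could serve for the exchange. Here a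
  product depends on the order of its factors, so the exchange must cost exactly one factor
  \<open>-q\<close>: the paths between the two in the product must not notice which tail they are
  moved past, and no value of the permutation may lie between the two exchanged ones. Taking the
  last common vertex gives both. The function x - y gives a meaning to the word last for all paths
  at once, since it increases strictly along horizontal and vertical edges alike. For the same
  reason it parametrises every path, so the order of the sinks follows from real functions and the
  intermediate value theorem, without a curve separation argument. Only H-edges have a weight other
  than \<open>1\<close>, a quotient of a term for the end by a term for the start. Commutation
  exponents are therefore sums of increments over H-edges; the abscissa along a path has the same
  shape, and \<open>hsum\<close> serves both.\<close>

lemma is_path_successively:
  "is_path E p u v \<longleftrightarrow> p \<noteq> [] \<and> hd p = u \<and> last p = v \<and> successively (\<lambda>a b. (a, b) \<in> E) p"
  by (auto simp: is_path_def successively_conv_nth less_diff_conv)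

lemma is_path_split:
  "is_path E (as @ v # bs) u w \<longleftrightarrow> is_path E (as @ [v]) u v \<and> is_path E (v # bs) v w"
  unfolding is_path_successively by (auto simp: successively_append_iff hd_append)

lemma is_path_Cons_Cons:
  "is_path E (a # b # p) u w \<longleftrightarrow> u = a \<and> (a, b) \<in> E \<and> is_path E (b # p) b w"
  unfolding is_path_successively by auto

lemma is_path_ends: "is_path E p u v \<Longrightarrow> u \<in> set p \<and> v \<in> set p"
  unfolding is_path_def by (metis hd_in_set last_in_set)

text \<open>Over all edges these increments would telescope. Leaving out the V-edges creates a
  defect, and every later evaluation consists in computing that defect.\<close>

fun hsum :: "('v \<Rightarrow> point) \<Rightarrow> ('v \<Rightarrow> 'b::ab_group_add) \<Rightarrow> 'v list \<Rightarrow> 'b" where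
  "hsum pos f (u # v # p) = (if is_H pos u v then f v - f u else 0) + hsum pos f (v # p)"
| "hsum pos f [u] = 0"
| "hsum pos f [] = 0"

lemma hsum_split: "hsum pos f (as @ v # bs) = hsum pos f (as @ [v]) + hsum pos f (v # bs)"
proof (induction as)
  case (Cons a as)
  then show ?case by (cases as) (auto simp: add.assoc)
qed auto

lemma hsum_cong: "(\<And>w. w \<in> set p \<Longrightarrow> f w = g w) \<Longrightarrow> hsum pos f p = hsum pos g p"
  by (induction pos f p rule: hsum.induct) auto

lemma hsum_const: "(\<And>w. w \<in> set p \<Longrightarrow> f w = a) \<Longrightarrow> hsum pos f p = 0"
  by (induction pos f p rule: hsum.induct) auto

lemma hsum_add: "hsum pos (\<lambda>w. f w + g w) p = hsum pos f p + hsum pos g p"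
  by (induction pos f p rule: hsum.induct) auto

lemma hsum_diff: "hsum pos (\<lambda>w. f w - g w) p = hsum pos f p - hsum pos g p"
  by (induction pos f p rule: hsum.induct) auto

lemma hsum_mult: "hsum pos (\<lambda>w. k * f w) p = (k::'b::ring) * hsum pos f p"
  by (induction pos f p rule: hsum.induct) (auto simp: algebra_simps)

lemma hsum_uminus: "hsum pos (\<lambda>w. - f w) p = - hsum pos f p"
  by (induction pos f p rule: hsum.induct) auto

lemma hsum_swap: "hsum pos (\<lambda>w. hsum pos (\<lambda>u. f u w) p) p' = hsum pos (\<lambda>u. hsum pos (\<lambda>w. f u w) p') p"
  by (induction pos "\<lambda>w. hsum pos (\<lambda>u. f u w) p" p' rule: hsum.induct)
    (auto simp: hsum_add hsum_diff hsum_const)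

text \<open>Interchanging the two summations turns the sum into its own negative; integer values
  allow the conclusion that it is zero.\<close>

lemma hsum_antisym:
  fixes f :: "'v \<Rightarrow> 'v \<Rightarrow> int"
  assumes "\<And>u w. f u w = - f w u"
  shows "hsum pos (\<lambda>w. hsum pos (\<lambda>u. f u w) p) p = 0"
proof -
  have "hsum pos (\<lambda>w. hsum pos (\<lambda>u. f u w) p) p = hsum pos (\<lambda>w. hsum pos (\<lambda>u. f w u) p) p"
    by (rule hsum_swap)
  also have "\<dots> = hsum pos (\<lambda>w. - hsum pos (\<lambda>u. f u w) p) p"
    unfolding hsum_uminus[symmetric] assms[symmetric] ..
  finally show ?thesis by (simp add: hsum_uminus)
qed

lemma continuous_on_hsum:
  fixes f :: "'v \<Rightarrow> 'a::topological_space \<Rightarrow> real"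
  assumes "\<And>w. continuous_on S (f w)"
  shows "continuous_on S (\<lambda>d. hsum pos (\<lambda>w. f w d) p)"
proof (induction p rule: induct_list012)
  case (3 u v p)
  then show ?case
    by (cases "is_H pos u v") (auto intro!: continuous_intros assms)
qed (auto intro!: continuous_intros)

definition diag :: "('v \<Rightarrow> point) \<Rightarrow> 'v \<Rightarrow> real" where
  "diag pos u = fst (pos u) - snd (pos u)"

section \<open>SE-graphs\<close>

locale se =
  fixes V :: "'v set" and E :: "('v \<times> 'v) set" and pos :: "'v \<Rightarrow> real \<times> real"
    and m n :: nat and r c :: "nat \<Rightarrow> 'v"
  assumes G: "se_graph V E pos m n r c"
begin

abbreviation "D \<equiv> diag pos"
abbreviation "sources \<equiv> r ` {1..m}"
abbreviation "sinks \<equiv> c ` {1..n}"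
abbreviation "W \<equiv> inner_vertices V m n r c"
abbreviation "epath \<equiv> successively (\<lambda>a b. (a, b) \<in> E)"

lemmas se_graph_conds = G[unfolded se_graph_def]

lemma fin_V: "finite V" and sources_V: "sources \<subseteq> V"
  and inj_r: "inj_on r {1..m}" and inj_c: "inj_on c {1..n}"
  and sources_sinks: "sources \<inter> sinks = {}"
  using se_graph_conds by - (elim conjE, assumption)+

lemma edge_V: "(u, v) \<in> E \<Longrightarrow> u \<in> V \<and> v \<in> V"
proof -
  have "E \<subseteq> V \<times> V" using se_graph_conds by - (elim conjE, assumption)
  then show "(u, v) \<in> E \<Longrightarrow> u \<in> V \<and> v \<in> V" by auto
qed

lemma edge_HV: "(u, v) \<in> E \<Longrightarrow> is_H pos u v \<or> is_V pos u v"
proof -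
  have "\<forall>(u,v)\<in>E. is_H pos u v \<or> is_V pos u v" using se_graph_conds by - (elim conjE, assumption)
  then show "(u, v) \<in> E \<Longrightarrow> is_H pos u v \<or> is_V pos u v" by auto
qed

lemma planar:
  assumes "e \<in> E" "e' \<in> E" "e \<noteq> e'"
  shows "edge_seg pos e \<inter> edge_seg pos e' \<subseteq> pos ` ({fst e, snd e} \<inter> {fst e', snd e'})"
proof -
  have "\<forall>e\<in>E. \<forall>e'\<in>E. e \<noteq> e' \<longrightarrow>
        edge_seg pos e \<inter> edge_seg pos e' \<subseteq> pos ` ({fst e, snd e} \<inter> {fst e', snd e'})"
    using se_graph_conds by - (elim conjE, assumption)
  then show ?thesis using assms by blast
qed

lemma vertex_on_edge:
  assumes "w \<in> V" "e \<in> E" "pos w \<in> edge_seg pos e"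
  shows "w = fst e \<or> w = snd e"
proof -
  have "\<forall>w\<in>V. \<forall>e\<in>E. pos w \<in> edge_seg pos e \<longrightarrow> w = fst e \<or> w = snd e"
    using se_graph_conds by - (elim conjE, assumption)
  then show ?thesis using assms by blast
qed

lemma r_fst: "i \<in> {1..m} \<Longrightarrow> i' \<in> {1..m} \<Longrightarrow> fst (pos (r i)) = fst (pos (r i'))"
  and r_snd: "i \<in> {1..m} \<Longrightarrow> i' \<in> {1..m} \<Longrightarrow> i < i' \<Longrightarrow> snd (pos (r i)) < snd (pos (r i'))"
  and c_snd: "j \<in> {1..n} \<Longrightarrow> j' \<in> {1..n} \<Longrightarrow> snd (pos (c j)) = snd (pos (c j'))"
  and c_fst: "j \<in> {1..n} \<Longrightarrow> j' \<in> {1..n} \<Longrightarrow> j < j' \<Longrightarrow> fst (pos (c j)) < fst (pos (c j'))"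
proof -
  have *: "\<forall>i\<in>{1..m}. \<forall>i'\<in>{1..m}. fst (pos (r i)) = fst (pos (r i'))"
     "\<forall>i\<in>{1..m}. \<forall>i'\<in>{1..m}. i < i' \<longrightarrow> snd (pos (r i)) < snd (pos (r i'))"
     "\<forall>j\<in>{1..n}. \<forall>j'\<in>{1..n}. snd (pos (c j)) = snd (pos (c j'))"
     "\<forall>j\<in>{1..n}. \<forall>j'\<in>{1..n}. j < j' \<longrightarrow> fst (pos (c j)) < fst (pos (c j'))"
    using se_graph_conds by - (elim conjE, assumption)+
  show "i \<in> {1..m} \<Longrightarrow> i' \<in> {1..m} \<Longrightarrow> fst (pos (r i)) = fst (pos (r i'))"
    "i \<in> {1..m} \<Longrightarrow> i' \<in> {1..m} \<Longrightarrow> i < i' \<Longrightarrow> snd (pos (r i)) < snd (pos (r i'))"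
    "j \<in> {1..n} \<Longrightarrow> j' \<in> {1..n} \<Longrightarrow> snd (pos (c j)) = snd (pos (c j'))"
    "j \<in> {1..n} \<Longrightarrow> j' \<in> {1..n} \<Longrightarrow> j < j' \<Longrightarrow> fst (pos (c j)) < fst (pos (c j'))"
    using * by blast+
qed

lemma source_H: "(u, v) \<in> E \<Longrightarrow> u \<in> sources \<or> v \<in> sources \<Longrightarrow> is_H pos u v"
  and sink_V: "(u, v) \<in> E \<Longrightarrow> u \<in> sinks \<or> v \<in> sinks \<Longrightarrow> is_V pos u v"
proof -
  have *: "\<forall>(u,v)\<in>E. u \<in> sources \<or> v \<in> sources \<longrightarrow> is_H pos u v"
    "\<forall>(u,v)\<in>E. u \<in> sinks \<or> v \<in> sinks \<longrightarrow> is_V pos u v"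
    using se_graph_conds by - (elim conjE, assumption)+
  show "(u, v) \<in> E \<Longrightarrow> u \<in> sources \<or> v \<in> sources \<Longrightarrow> is_H pos u v"
    "(u, v) \<in> E \<Longrightarrow> u \<in> sinks \<or> v \<in> sinks \<Longrightarrow> is_V pos u v"
    using * by blast+
qed

lemma on_path:
  assumes "w \<in> V"
  shows "\<exists>i\<in>{1..m}. \<exists>j\<in>{1..n}. \<exists>p. is_path E p (r i) (c j) \<and> w \<in> set p"
proof -
  have "\<forall>w\<in>V. \<exists>i\<in>{1..m}. \<exists>j\<in>{1..n}. \<exists>p. is_path E p (r i) (c j) \<and> w \<in> set p"
    using se_graph_conds by - (elim conjE, assumption)
  then show ?thesis using assms by blast
qed

section \<open>Monotonicity of the coordinates along directed paths\<close>

lemma H_not_V: "is_H pos u v \<Longrightarrow> \<not> is_V pos u v"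
  by (auto simp: is_H_def is_V_def)

lemma edge_diag: "(u, v) \<in> E \<Longrightarrow> D u < D v"
  using edge_HV[of u v] by (auto simp: diag_def is_H_def is_V_def)

lemma edge_mono: "(u, v) \<in> E \<Longrightarrow> fst (pos u) \<le> fst (pos v) \<and> snd (pos v) \<le> snd (pos u)"
  using edge_HV[of u v] by (auto simp: is_H_def is_V_def)

lemma epath_diag: "epath p \<Longrightarrow> sorted_wrt (\<lambda>a b. D a < D b) p"
  by (subst successively_conv_sorted_wrt[symmetric])
    (auto simp: transp_def intro: edge_diag elim: successively_mono)

lemma epath_mono:
  "epath p \<Longrightarrow> sorted_wrt (\<lambda>a b. fst (pos a) \<le> fst (pos b) \<and> snd (pos b) \<le> snd (pos a)) p"
  by (subst successively_conv_sorted_wrt[symmetric])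
    (auto simp: transp_def dest: edge_mono elim!: successively_mono)

lemma epath_distinct: "epath p \<Longrightarrow> distinct p"
  using epath_diag[of p] by (auto simp: sorted_wrt_iff_nth_less distinct_conv_nth)
    (metis linorder_neqE_nat order_less_irrefl)

lemma epath_V: "epath (u # p) \<Longrightarrow> u \<in> V \<Longrightarrow> set (u # p) \<subseteq> V"
  by (induction p arbitrary: u) (auto dest: edge_V)

lemma path_V: "is_path E p u v \<Longrightarrow> u \<in> V \<Longrightarrow> set p \<subseteq> V"
  using epath_V[of u "tl p"] by (cases p) (auto simp: is_path_successively)

lemma path_bounds:
  assumes "is_path E p u v" "w \<in> set p"
  shows "fst (pos u) \<le> fst (pos w)" "snd (pos w) \<le> snd (pos u)"
    "fst (pos w) \<le> fst (pos v)" "snd (pos v) \<le> snd (pos w)" "D u \<le> D w" "D w \<le> D v"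
proof -
  have e: "epath p" "p \<noteq> []" and u: "hd p = u" and v: "last p = v"
    using assms by (auto simp: is_path_successively)
  obtain p' where p': "p = u # p'" using e u by (cases p) auto
  show 1: "fst (pos u) \<le> fst (pos w)" "snd (pos w) \<le> snd (pos u)"
    using epath_mono[OF e(1)] assms(2) unfolding p' by auto
  obtain p'' where p'': "p = p'' @ [v]" using e v by (metis append_butlast_last_id)
  show 2: "fst (pos w) \<le> fst (pos v)" "snd (pos v) \<le> snd (pos w)"
    using epath_mono[OF e(1)] assms(2) unfolding p'' by (auto simp: sorted_wrt_append)
  show "D u \<le> D w" "D w \<le> D v" using 1 2 by (auto simp: diag_def)
qed

text \<open>Every vertex lies on a path from a source to a sink, and coordinates are monotone along
  it. The line of sources thus bounds the graph on the left and the line of sinks bounds it below,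
  which rules out edges into sources and out of sinks.\<close>

lemma vertex_bounds:
  assumes "w \<in> V"
  shows "i \<in> {1..m} \<Longrightarrow> fst (pos (r i)) \<le> fst (pos w)"
    and "j \<in> {1..n} \<Longrightarrow> snd (pos (c j)) \<le> snd (pos w)"
proof -
  obtain i' j' p where *: "i' \<in> {1..m}" "j' \<in> {1..n}" "is_path E p (r i') (c j')" "w \<in> set p"
    using on_path[OF assms] by blast
  show "i \<in> {1..m} \<Longrightarrow> fst (pos (r i)) \<le> fst (pos w)"
    using path_bounds(1)[OF *(3,4)] r_fst[of i i'] * by auto
  show "j \<in> {1..n} \<Longrightarrow> snd (pos (c j)) \<le> snd (pos w)"
    using path_bounds(4)[OF *(3,4)] c_snd[of j j'] * by auto
qed

lemma no_edge_into_source: "(u, v) \<in> E \<Longrightarrow> v \<notin> sources"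
  using source_H[of u v] vertex_bounds(1)[of u] edge_V[of u v] by (fastforce simp: is_H_def)

lemma no_edge_from_sink: "(u, v) \<in> E \<Longrightarrow> u \<notin> sinks"
  using sink_V[of u v] vertex_bounds(2)[of v] edge_V[of u v] by (fastforce simp: is_V_def)

lemma H_seg:
  assumes "is_H pos u v"
  shows "(a, b) \<in> edge_seg pos (u, v) \<longleftrightarrow> b = snd (pos u) \<and> fst (pos u) \<le> a \<and> a \<le> fst (pos v)"
  using assms closed_segment_same_snd[of "pos u" "pos v"]
  by (auto simp: edge_seg_def is_H_def closed_segment_eq_real_ivl)

lemma V_seg:
  assumes "is_V pos u v"
  shows "(a, b) \<in> edge_seg pos (u, v) \<longleftrightarrow> a = fst (pos u) \<and> snd (pos v) \<le> b \<and> b \<le> snd (pos u)"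
  using assms closed_segment_same_fst[of "pos u" "pos v"]
  by (auto simp: edge_seg_def is_V_def closed_segment_eq_real_ivl)

text \<open>Of two such edges the shorter would end on the longer one, but an edge contains no
  vertex besides its ends. The three analogues are proved in the same way.\<close>

lemma H_out_unique:
  assumes "(u, v) \<in> E" "(u, v') \<in> E" "is_H pos u v" "is_H pos u v'"
  shows "v = v'"
proof -
  have "v = v'" if "(u, v) \<in> E" "(u, v') \<in> E" "is_H pos u v" "is_H pos u v'" "fst (pos v) \<le> fst (pos v')" for v v'
  proof -
    have "(fst (pos v), snd (pos v)) \<in> edge_seg pos (u, v')"
      unfolding H_seg[OF that(4)] using that by (auto simp: is_H_def)
    then show ?thesis using vertex_on_edge[of v "(u, v')"] that edge_V[of u v] edge_diag[of u v] by auto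
  qed
  then show ?thesis using assms by (metis linear)
qed

lemma H_in_unique:
  assumes "(u, v) \<in> E" "(u', v) \<in> E" "is_H pos u v" "is_H pos u' v"
  shows "u = u'"
proof -
  have "u = u'" if "(u, v) \<in> E" "(u', v) \<in> E" "is_H pos u v" "is_H pos u' v" "fst (pos u') \<le> fst (pos u)" for u u'
  proof -
    have "(fst (pos u), snd (pos u)) \<in> edge_seg pos (u', v)"
      unfolding H_seg[OF that(4)] using that by (auto simp: is_H_def)
    then show ?thesis using vertex_on_edge[of u "(u', v)"] that edge_V[of u v] edge_diag[of u v] by auto
  qed
  then show ?thesis using assms by (metis linear)
qed

lemma V_out_unique:
  assumes "(u, v) \<in> E" "(u, v') \<in> E" "is_V pos u v" "is_V pos u v'"
  shows "v = v'"
proof -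
  have "v = v'" if "(u, v) \<in> E" "(u, v') \<in> E" "is_V pos u v" "is_V pos u v'" "snd (pos v') \<le> snd (pos v)" for v v'
  proof -
    have "(fst (pos v), snd (pos v)) \<in> edge_seg pos (u, v')"
      unfolding V_seg[OF that(4)] using that by (auto simp: is_V_def)
    then show ?thesis using vertex_on_edge[of v "(u, v')"] that edge_V[of u v] edge_diag[of u v] by auto
  qed
  then show ?thesis using assms by (metis linear)
qed

lemma V_in_unique:
  assumes "(u, v) \<in> E" "(u', v) \<in> E" "is_V pos u v" "is_V pos u' v"
  shows "u = u'"
proof -
  have "u = u'" if "(u, v) \<in> E" "(u', v) \<in> E" "is_V pos u v" "is_V pos u' v" "snd (pos u) \<le> snd (pos u')" for u u'
  proof -
    have "(fst (pos u), snd (pos u)) \<in> edge_seg pos (u', v)"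
      unfolding V_seg[OF that(4)] using that by (auto simp: is_V_def)
    then show ?thesis using vertex_on_edge[of u "(u', v)"] that edge_V[of u v] edge_diag[of u v] by auto
  qed
  then show ?thesis using assms by (metis linear)
qed

end

section \<open>Order of the sinks\<close>

context se
begin

text \<open>
  Prolong a path by a horizontal ray to the left of its start and a vertical ray below its end:
  \<open>xat p d\<close> is the abscissa of the unique point of the prolonged path on the line \<open>x - y = d\<close>.
  It is continuous in \<open>d\<close>, so the intermediate value theorem detects crossings.
\<close>

definition xat :: "'v list \<Rightarrow> real \<Rightarrow> real" where
  "xat p d = snd (pos (hd p)) + min d (D (hd p)) + hsum pos (\<lambda>w. min d (D w)) p"

lemma xat_left:
  assumes "is_path E p u v" "d \<le> D u"
  shows "xat p d = snd (pos u) + d"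
proof -
  have "hsum pos (\<lambda>w. min d (D w)) p = 0"
    by (rule hsum_const[where a = d]) (use path_bounds(5)[OF assms(1)] assms(2) in force)
  then show ?thesis using assms by (auto simp: xat_def is_path_def)
qed

lemma hsum_diag: "epath p \<Longrightarrow> p \<noteq> [] \<Longrightarrow> hsum pos D p = fst (pos (last p)) - fst (pos (hd p))"
proof (induction p rule: induct_list012)
  case (3 u v p)
  then show ?case using edge_HV[of u v] H_not_V[of u v]
    by (auto simp: diag_def is_H_def is_V_def)
qed auto

lemma xat_right:
  assumes "is_path E p u v" "D v \<le> d"
  shows "xat p d = fst (pos v)"
proof -
  have p: "epath p" "p \<noteq> []" "hd p = u" "last p = v" using assms by (auto simp: is_path_successively)
  have "D u \<le> d" using path_bounds(6)[OF assms(1), of u] p assms(2) by fastforce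
  have "hsum pos (\<lambda>w. min d (D w)) p = hsum pos D p"
    by (rule hsum_cong) (use path_bounds(6)[OF assms(1)] assms(2) in force)
  then show ?thesis using p \<open>D u \<le> d\<close> by (auto simp: xat_def hsum_diag diag_def)
qed

text \<open>Beyond \<open>v\<close> the prefix has accumulated exactly the abscissa of
  \<open>v\<close>, and this is the value with which the tail alone starts.\<close>

lemma xat_tail:
  assumes "is_path E (as @ v # bs) u w" "D v \<le> d"
  shows "xat (as @ v # bs) d = xat (v # bs) d"
proof -
  have "is_path E (as @ [v]) u v" using assms is_path_split by metis
  from xat_right[OF this assms(2)]
  have "xat (as @ [v]) d = fst (pos v)" .
  moreover have "hd (as @ v # bs) = hd (as @ [v])" by (cases as) auto
  ultimately show ?thesis using assms(2) unfolding xat_def hsum_split[of pos _ as v bs]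
    by (auto simp: diag_def)
qed

lemma xat_first_edge:
  assumes "is_path E (a # b # p) a v" "D a \<le> d" "d \<le> D b"
  shows "xat (a # b # p) d = (if is_H pos a b then fst (pos a) + (d - D a) else fst (pos a))"
proof -
  have p: "is_path E (b # p) b v" using assms by (auto simp: is_path_Cons_Cons)
  have "hsum pos (\<lambda>w. min d (D w)) (b # p) = 0"
    by (rule hsum_const[where a = d]) (use path_bounds(5)[OF p] assms(3) in force)
  then show ?thesis using assms by (auto simp: xat_def diag_def)
qed

text \<open>This ties the formula for \<open>xat\<close> to the drawing. The bound on
  \<open>D b\<close> is kept for the case that two paths run through the same edge: then
  \<open>b\<close> is a common vertex that is not before the line.\<close>

lemma xat_mid:
  assumes "is_path E p u v" "2 \<le> length p" "D u \<le> d" "d \<le> D v"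
  shows "\<exists>a b. (a, b) \<in> E \<and> a \<in> set p \<and> b \<in> set p \<and> d \<le> D b \<and>
    (xat p d, xat p d - d) \<in> edge_seg pos (a, b)"
  using assms
proof (induction p arbitrary: u rule: induct_list012)
  case (3 a b p)
  have [simp]: "u = a" and e: "(a, b) \<in> E" and p: "is_path E (b # p) b v"
    using 3 by (auto simp: is_path_Cons_Cons)
  show ?case
  proof (cases "d \<le> D b")
    case True
    have x: "xat (a # b # p) d = (if is_H pos a b then fst (pos a) + (d - D a) else fst (pos a))"
      using xat_first_edge 3 True by auto
    have "(xat (a # b # p) d, xat (a # b # p) d - d) \<in> edge_seg pos (a, b)"
    proof (cases "is_H pos a b")
      case H: True
      then show ?thesis unfolding H_seg[OF H] using x True \<open>D u \<le> d\<close> by (auto simp: diag_def is_H_def)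
    next
      case False
      then have V: "is_V pos a b" using edge_HV[OF e] by auto
      show ?thesis unfolding V_seg[OF V] using V x False True \<open>D u \<le> d\<close>
        by (auto simp: diag_def is_V_def)
    qed
    then show ?thesis using e True by (intro exI[of _ a] exI[of _ b]) auto
  next
    case False
    have "p \<noteq> []" using False 3 p by (auto simp: is_path_def)
    then have "2 \<le> length (b # p)" by (cases p) auto
    from "3.IH"(2)[OF p this] False 3
    obtain a' b' where "(a', b') \<in> E" "a' \<in> set (b # p)" "b' \<in> set (b # p)" "d \<le> D b'"
      "(xat (b # p) d, xat (b # p) d - d) \<in> edge_seg pos (a', b')" by fastforce
    moreover have "xat (a # b # p) d = xat (b # p) d"
      using xat_tail[of "[a]" b p u v d] 3(3) False by auto
    ultimately show ?thesis by (intro exI[of _ a'] exI[of _ b']) auto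
  qed
qed auto

lemma edge_seg_bounds:
  assumes "(a, b) \<in> E" "(x, y) \<in> edge_seg pos (a, b)"
  shows "fst (pos a) \<le> x" "snd (pos b) \<le> y"
  using edge_HV[OF assms(1)] assms(2) H_seg[of a b x y] V_seg[of a b x y]
  by (auto simp: is_H_def is_V_def)

lemma full_path_length: "i \<in> {1..m} \<Longrightarrow> j \<in> {1..n} \<Longrightarrow> is_path E p (r i) (c j) \<Longrightarrow> 2 \<le> length p"
proof -
  assume *: "i \<in> {1..m}" "j \<in> {1..n}" "is_path E p (r i) (c j)"
  have "r i \<noteq> c j" using sources_sinks *(1,2) by blast
  then show "2 \<le> length p" using *(3) by (cases p; cases "tl p") (auto simp: is_path_def)
qed

lemma xat_ge:
  assumes "is_path E p u v" "2 \<le> length p" "D u \<le> d"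
  shows "fst (pos u) \<le> xat p d"
proof (cases "d \<le> D v")
  case True
  then show ?thesis using xat_mid[OF assms True] edge_seg_bounds path_bounds(1)[OF assms(1)]
    by (meson order_trans)
next
  case False
  have "v \<in> set p" using assms(1) by (auto simp: is_path_def)
  with False show ?thesis using xat_right[OF assms(1), of d] path_bounds(1)[OF assms(1)] by auto
qed

lemma xat_snd_ge:
  assumes "is_path E p u v" "2 \<le> length p" "d \<le> D v"
  shows "snd (pos v) \<le> xat p d - d"
proof (cases "D u \<le> d")
  case True
  then show ?thesis using xat_mid[OF assms(1,2) True assms(3)] edge_seg_bounds path_bounds(4)[OF assms(1)]
    by (meson order_trans)
next
  case False
  have "u \<in> set p" using assms(1) by (auto simp: is_path_def)
  with False show ?thesis using xat_left[OF assms(1), of d] path_bounds(4)[OF assms(1)] by auto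
qed

text \<open>The prolonging rays create no spurious meetings: the left rays of different sources have
  different heights and reach no vertex further left, and the lower rays of different sinks have
  different abscissas below the graph. Otherwise the meeting point lies on an edge of each path, and
  planarity applies.\<close>

lemma xat_eq_imp_common:
  assumes i: "i \<in> {1..m}" "i' \<in> {1..m}" and j: "j \<in> {1..n}" "j' \<in> {1..n}" "j \<noteq> j'"
    and p: "is_path E p (r i) (c j)" and p': "is_path E p' (r i') (c j')"
    and eq: "xat p d = xat p' d"
  shows "\<exists>w \<in> set p \<inter> set p'. d \<le> D w"
proof -
  note len = full_path_length[OF i(1) j(1) p] full_path_length[OF i(2) j(2) p']
  have mem: "r i \<in> set p" "r i' \<in> set p'" using is_path_ends p p' by metis+
  consider "d < D (r i)" | "D (r i) \<le> d" "d < D (r i')"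
    | "D (r i) \<le> d" "D (r i') \<le> d" "D (c j) < d"
    | "D (r i) \<le> d" "D (r i') \<le> d" "d \<le> D (c j)" "D (c j') < d"
    | "D (r i) \<le> d" "D (r i') \<le> d" "d \<le> D (c j)" "d \<le> D (c j')" by linarith
  then show ?thesis
  proof cases
    case 1
    then have x: "xat p d = snd (pos (r i)) + d" using xat_left[OF p] by auto
    then have "xat p' d < fst (pos (r i'))" using 1 eq r_fst[OF i] by (auto simp: diag_def)
    then have "d < D (r i')" using xat_ge[OF p' len(2), of d] by linarith
    then have "snd (pos (r i)) = snd (pos (r i'))" using x eq xat_left[OF p', of d] by auto
    then have "i = i'" using r_snd[OF i] r_snd[OF i(2,1)] by (metis linorder_neqE_nat order_less_irrefl)
    then show ?thesis using mem 1 by force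
  next
    case 2
    then have x: "xat p' d = snd (pos (r i')) + d" using xat_left[OF p'] by auto
    then have "xat p d < fst (pos (r i))" using 2 eq r_fst[OF i] by (auto simp: diag_def)
    then show ?thesis using xat_ge[OF p len(1), of d] 2 by linarith
  next
    case 3
    have "xat p d = fst (pos (c j))" using 3 xat_right[OF p] by auto
    then have "xat p' d - d < snd (pos (c j'))" using 3 eq c_snd[OF j(1,2)] by (auto simp: diag_def)
    then have "D (c j') < d" using xat_snd_ge[OF p' len(2), of d] by linarith
    then have "fst (pos (c j)) = fst (pos (c j'))"
      using 3 eq xat_right[OF p, of d] xat_right[OF p', of d] by auto
    then show ?thesis using c_fst[OF j(1,2)] c_fst[OF j(2,1)] j(3)
      by (metis linorder_neqE_nat order_less_irrefl)
  next
    case 4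
    have "xat p' d = fst (pos (c j'))" using 4 xat_right[OF p'] by auto
    then have "xat p d - d < snd (pos (c j))" using 4 eq c_snd[OF j(1,2)] by (auto simp: diag_def)
    then show ?thesis using xat_snd_ge[OF p len(1), of d] 4 by linarith
  next
    case 5
    obtain a b where ab: "(a, b) \<in> E" "a \<in> set p" "b \<in> set p" "d \<le> D b"
      "(xat p d, xat p d - d) \<in> edge_seg pos (a, b)"
      using xat_mid[OF p len(1) 5(1,3)] by auto
    obtain a' b' where ab': "(a', b') \<in> E" "a' \<in> set p'" "b' \<in> set p'" "d \<le> D b'"
      "(xat p d, xat p d - d) \<in> edge_seg pos (a', b')"
      using xat_mid[OF p' len(2) 5(2,4)] eq by auto
    show ?thesis
    proof (cases "(a, b) = (a', b')")
      \<comment> \<open>On a shared edge the meeting point need not be a vertex; the end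
        \<open>b\<close> of the edge serves instead.\<close>
      case True
      then show ?thesis using ab ab' by auto
    next
      case False
      then obtain w where w: "pos w = (xat p d, xat p d - d)" "w \<in> {a, b} \<inter> {a', b'}"
        using planar[OF ab(1) ab'(1)] ab(5) ab'(5) by fastforce
      then have "D w = d" by (auto simp: diag_def)
      then show ?thesis using w ab ab' by auto
    qed
  qed
qed

lemma continuous_xat: "continuous_on S (xat p)"
  unfolding xat_def by (intro continuous_intros continuous_on_hsum)

text \<open>Beyond both sinks \<open>xat\<close> is the abscissa of the sink. Sinks in the wrong
  order would make the difference change sign after \<open>d\<close>, and its zero would yield a
  common vertex not before \<open>d\<close>.\<close>

lemma sink_order:
  assumes i: "i \<in> {1..m}" "i' \<in> {1..m}" and j: "j \<in> {1..n}" "j' \<in> {1..n}" "j \<noteq> j'"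
    and p: "is_path E p (r i) (c j)" and p': "is_path E p' (r i') (c j')"
    and apart: "\<And>w. w \<in> set p \<Longrightarrow> w \<in> set p' \<Longrightarrow> D w < d"
    and less: "xat p d < xat p' d"
  shows "j < j'"
proof (rule ccontr)
  assume "\<not> j < j'"
  then have "j' < j" using j by auto
  define d1 where "d1 = Max {d, D (c j), D (c j')}"
  have d1: "d \<le> d1" "D (c j) \<le> d1" "D (c j') \<le> d1" by (auto simp: d1_def)
  have "xat p' d1 < xat p d1"
    using xat_right[OF p d1(2)] xat_right[OF p' d1(3)] c_fst[OF j(2,1) \<open>j' < j\<close>] by auto
  then have "\<exists>e\<ge>d. e \<le> d1 \<and> xat p e - xat p' e = 0"
    using less d1 by (intro IVT') (auto intro!: continuous_intros continuous_xat)
  then obtain e where e: "d \<le> e" "xat p e = xat p' e" by auto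
  from xat_eq_imp_common[OF i j p p' e(2)] apart e(1) show False by force
qed

lemma disjoint_sink_order:
  assumes i: "i \<in> {1..m}" "i' \<in> {1..m}" "i < i'" and j: "j \<in> {1..n}" "j' \<in> {1..n}"
    and p: "is_path E p (r i) (c j)" and p': "is_path E p' (r i') (c j')"
    and disj: "set p \<inter> set p' = {}"
  shows "j < j'"
proof -
  have "c j \<in> set p" "c j' \<in> set p'" using is_path_ends p p' by metis+
  then have "j \<noteq> j'" using disj by auto
  \<comment> \<open>On the line through the upper source \<open>r i'\<close> the path
    \<open>p\<close> is still on its left ray, since a lower source has a larger value of
    \<open>D\<close>.\<close>
  have "xat p (D (r i')) < xat p' (D (r i'))"
    using xat_left[OF p', of "D (r i')"] xat_left[OF p, of "D (r i')"] r_fst[OF i(1,2)] r_snd[OF i]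
    by (auto simp: diag_def)
  with sink_order[OF i(1,2) j \<open>j \<noteq> j'\<close> p p'] disj show ?thesis by blast
qed

lemma branching_sink_order:
  assumes i: "i \<in> {1..m}" "i' \<in> {1..m}" and j: "j \<in> {1..n}" "j' \<in> {1..n}" "j \<noteq> j'"
    and p: "is_path E (as @ v # a # A) (r i) (c j)" and p': "is_path E (bs @ v # b # B) (r i') (c j')"
    and a: "is_V pos v a" and b: "is_H pos v b"
    and apart: "\<And>w. w \<in> set (as @ v # a # A) \<Longrightarrow> w \<in> set (bs @ v # b # B) \<Longrightarrow> D w \<le> D v"
  shows "j < j'"
proof -
  \<comment> \<open>A line just after \<open>v\<close>, met by both paths on their first edge after
    \<open>v\<close>: the vertical one still has the abscissa of \<open>v\<close>, the horizontal
    one has already moved to the right.\<close>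
  define d where "d = min (D a) (D b)"
  have pa: "is_path E (v # a # A) v (c j)" and pb: "is_path E (v # b # B) v (c j')"
    using p p' is_path_split by metis+
  have d: "D v < d" "d \<le> D a" "d \<le> D b"
    using edge_diag[of v a] edge_diag[of v b] pa pb by (auto simp: d_def is_path_Cons_Cons)
  have "xat (as @ v # a # A) d < xat (bs @ v # b # B) d"
    using xat_first_edge[OF pa _ d(2)] xat_first_edge[OF pb _ d(3)] xat_tail[OF p, of d] xat_tail[OF p', of d]
      d a b H_not_V by auto
  then show ?thesis using apart d by (intro sink_order[OF i j p p']) (auto dest!: apart simp del: set_append)
qed

text \<open>On the line through \<open>v\<close> both paths are at \<open>v\<close>. As
  \<open>R\<close> avoids them from there on, it is strictly left or strictly right of both, and its
  sink stays on that side.\<close>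

lemma sink_not_between:
  assumes i: "i \<in> {1..m}" "i' \<in> {1..m}" "i'' \<in> {1..m}"
    and j: "j \<in> {1..n}" "j' \<in> {1..n}" "j'' \<in> {1..n}" "j'' \<noteq> j" "j'' \<noteq> j'"
    and p: "is_path E (as @ v # A) (r i) (c j)" and p': "is_path E (bs @ v # B) (r i') (c j')"
    and p'': "is_path E R (r i'') (c j'')"
    and apart: "\<And>w. w \<in> set (as @ v # A) \<Longrightarrow> w \<in> set R \<Longrightarrow> D w < D v"
    and apart': "\<And>w. w \<in> set (bs @ v # B) \<Longrightarrow> w \<in> set R \<Longrightarrow> D w < D v"
  shows "\<not> (j < j'' \<and> j'' < j')"
proof -
  have pt: "is_path E (v # A) v (c j)" "is_path E (v # B) v (c j')"
    using p[THEN is_path_split[THEN iffD1]] p'[THEN is_path_split[THEN iffD1]] by blast+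
  have x: "xat (as @ v # A) (D v) = fst (pos v)" "xat (bs @ v # B) (D v) = fst (pos v)"
    using xat_tail[OF p, of "D v"] xat_tail[OF p', of "D v"] xat_left[OF pt(1), of "D v"]
      xat_left[OF pt(2), of "D v"] by (auto simp: diag_def)
  consider "xat R (D v) < fst (pos v)" | "xat R (D v) = fst (pos v)" | "xat R (D v) > fst (pos v)"
    by linarith
  then show ?thesis
  proof cases
    case 1
    then have "j'' < j" using x apart j by (intro sink_order[OF i(3,1) j(3,1) _ p'' p, of "D v"]) auto
    then show ?thesis by auto
  next
    case 2
    then show ?thesis using xat_eq_imp_common[OF i(3,1) j(3,1,4) p'' p, of "D v"] x apart by force
  next
    case 3
    then have "j' < j''" using x apart' j by (intro sink_order[OF i(2,3) j(2,3) _ p' p'', of "D v"]) auto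
    then show ?thesis by auto
  qed
qed

end

section \<open>The skew form\<close>

lemma trancl_iff_is_path: "(u, v) \<in> R\<^sup>+ \<longleftrightarrow> (\<exists>p. is_path R p u v \<and> length p \<ge> 2)"
proof
  assume "(u, v) \<in> R\<^sup>+"
  then show "\<exists>p. is_path R p u v \<and> length p \<ge> 2"
  proof (induction rule: converse_trancl_induct)
    case (base y)
    then show ?case by (intro exI[of _ "[y, v]"]) (auto simp: is_path_successively)
  next
    case (step y z)
    then obtain p where p: "is_path R p z v" "length p \<ge> 2" by auto
    then obtain p' where "p = z # p'" by (cases p) (auto simp: is_path_def)
    then show ?case using p step by (intro exI[of _ "y # p"]) (auto simp: is_path_Cons_Cons)
  qed
next
  assume "\<exists>p. is_path R p u v \<and> length p \<ge> 2"
  then obtain p where "is_path R p u v" "length p \<ge> 2" by auto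
  then show "(u, v) \<in> R\<^sup>+"
  proof (induction p arbitrary: u rule: induct_list012)
    case (3 a b p)
    then show ?case
      by (cases p) (auto simp: is_path_Cons_Cons is_path_def[of _ "[_]"] intro: trancl_into_trancl2)
  qed auto
qed

lemma trancl_into_unique:
  assumes "(u, v) \<in> R" "\<And>u'. (u', v) \<in> R \<Longrightarrow> u' = u"
  shows "(w, v) \<in> R\<^sup>+ \<longleftrightarrow> w = u \<or> (w, u) \<in> R\<^sup>+"
  using assms by (metis r_into_trancl rtrancl_eq_or_trancl trancl.trancl_into_trancl tranclD2)

lemma trancl_from_unique:
  assumes "(u, v) \<in> R" "\<And>v'. (u, v') \<in> R \<Longrightarrow> v' = v"
  shows "(u, w) \<in> R\<^sup>+ \<longleftrightarrow> w = v \<or> (v, w) \<in> R\<^sup>+"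
  using assms by (metis r_into_trancl rtrancl_eq_or_trancl trancl_into_trancl2 tranclD)

context se
begin

definition "HE = {(u, v). (u, v) \<in> E \<and> is_H pos u v}"
definition "VE = {(u, v). (u, v) \<in> E \<and> is_V pos u v}"

lemma hpath_iff: "hpath E pos u v \<longleftrightarrow> (u, v) \<in> HE\<^sup>+"
  unfolding trancl_iff_is_path hpath_def by (auto simp: is_path_def HE_def)

lemma vpath_iff: "vpath E pos u v \<longleftrightarrow> (u, v) \<in> VE\<^sup>+"
  unfolding trancl_iff_is_path vpath_def by (auto simp: is_path_def VE_def)

lemma HE_trancl: "(u, v) \<in> HE\<^sup>+ \<Longrightarrow> is_H pos u v"
  by (induction rule: trancl_induct) (auto simp: HE_def is_H_def)

lemma VE_trancl: "(u, v) \<in> VE\<^sup>+ \<Longrightarrow> is_V pos u v"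
  by (induction rule: trancl_induct) (auto simp: VE_def is_V_def)

text \<open>
  The generators satisfy \<open>x u * x w = q powi (form u w) * x w * x u\<close>; sources and sinks, which are
  not generators, are given the value \<open>0\<close>.
\<close>

definition hform :: "'v \<Rightarrow> 'v \<Rightarrow> int" where
  "hform u w = of_bool ((u, w) \<in> HE\<^sup>+) - of_bool ((w, u) \<in> HE\<^sup>+)"

definition vform :: "'v \<Rightarrow> 'v \<Rightarrow> int" where
  "vform u w = of_bool ((w, u) \<in> VE\<^sup>+) - of_bool ((u, w) \<in> VE\<^sup>+)"

definition form :: "'v \<Rightarrow> 'v \<Rightarrow> int" where
  "form u w = (if u \<in> W \<and> w \<in> W then hform u w + vform u w else 0)"

text \<open>For a sink \<open>s\<close> this is \<open>vform s w\<close>, because no edge leaves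
  \<open>s\<close>. It restores the vertical pairing with the end of a path, which
  \<open>form\<close> suppresses as a sink is not a generator.\<close>

definition above :: "'v \<Rightarrow> 'v \<Rightarrow> int" where
  "above s w = of_bool ((w, s) \<in> VE\<^sup>+)"

lemma HE_edge:
  assumes "(u, v) \<in> E" "is_H pos u v"
  shows "(w, v) \<in> HE\<^sup>+ \<longleftrightarrow> w = u \<or> (w, u) \<in> HE\<^sup>+" "(u, w) \<in> HE\<^sup>+ \<longleftrightarrow> w = v \<or> (v, w) \<in> HE\<^sup>+"
  using assms H_in_unique H_out_unique
  by (auto simp: HE_def intro!: trancl_into_unique trancl_from_unique)

lemma VE_edge:
  assumes "(u, v) \<in> E" "is_V pos u v"
  shows "(w, v) \<in> VE\<^sup>+ \<longleftrightarrow> w = u \<or> (w, u) \<in> VE\<^sup>+" "(u, w) \<in> VE\<^sup>+ \<longleftrightarrow> w = v \<or> (v, w) \<in> VE\<^sup>+"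
  using assms V_in_unique V_out_unique
  by (auto simp: VE_def intro!: trancl_into_unique trancl_from_unique)

lemma HE_irrefl: "(u, u) \<notin> HE\<^sup>+" and VE_irrefl: "(u, u) \<notin> VE\<^sup>+"
  using HE_trancl[of u u] VE_trancl[of u u] by (auto simp: is_H_def is_V_def)

text \<open>H-edges form disjoint chains, so two neighbours see every third vertex on the same side;
  only the pairings with the two neighbours themselves change. In \<open>vform_edge\<close> the
  difference is taken in the opposite order, as the vertical relation is oriented the other
  way.\<close>

lemma hform_edge:
  assumes "(u, v) \<in> E" "is_H pos u v"
  shows "hform v w - hform u w = - of_bool (w = u) - of_bool (w = v)"
  using HE_irrefl by (auto simp: hform_def HE_edge[OF assms])

lemma vform_edge:
  assumes "(u, v) \<in> E" "is_V pos u v"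
  shows "vform u w - vform v w = - of_bool (w = u) - of_bool (w = v)"
  using VE_irrefl by (auto simp: vform_def VE_edge[OF assms])

lemma form_antisym: "form u w = - form w u"
  by (auto simp: form_def hform_def vform_def)

lemma W_iff: "w \<in> W \<longleftrightarrow> w \<in> V \<and> w \<notin> sources \<and> w \<notin> sinks"
  by (auto simp: inner_vertices_def)

lemma VE_from_sink: "s \<in> sinks \<Longrightarrow> (s, w) \<notin> VE\<^sup>+"
  using no_edge_from_sink[of s] by (auto dest!: tranclD simp: VE_def)

lemma VE_from_source: "s \<in> sources \<Longrightarrow> (s, w) \<notin> VE\<^sup>+"
  using source_H[of s] H_not_V[of s] by (auto dest!: tranclD simp: VE_def)

lemma epath_Cons_notin: "epath (u # p) \<Longrightarrow> u \<notin> set p"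
  using epath_distinct by fastforce

text \<open>The vertical part of \<open>form\<close> telescopes to
  \<open>vform s w - vform v w\<close> up to its increments on V-edges. With these and the
  horizontal increments, every edge of the path at \<open>w\<close>, of either kind, costs one. A
  vertex of the tail has two such edges, which gives the coefficient 2; the start \<open>v\<close>
  has only one, which gives the final correction.\<close>

lemma hsum_form_tail:
  assumes "is_path E p v s" "s \<in> sinks" "v \<in> W" "w \<in> W"
  shows "hsum pos (\<lambda>u. form u w) p =
    above s w - vform v w - 2 * of_bool (w \<in> set p) + of_bool (w = v)"
  using assms
proof (induction p arbitrary: v rule: induct_list012)
  case (2 u)
  then show ?case by (auto simp: is_path_def W_iff)
next
  case (3 a b p)
  have [simp]: "v = a" and e: "(a, b) \<in> E" and p: "is_path E (b # p) b s"
    and dist: "a \<notin> set (b # p)"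
    using "3.prems"(1) epath_Cons_notin[of a "b # p"] by (auto simp: is_path_Cons_Cons is_path_successively)
  show ?case
  proof (cases "b \<in> sinks")
    case True
    then have V: "is_V pos a b" using sink_V[OF e] by auto
    have "p = []" using p no_edge_from_sink[of b] True by (cases p) (auto simp: is_path_Cons_Cons)
    then have [simp]: "b = s" using p by (auto simp: is_path_def)
    have "w \<noteq> s" using "3.prems" by (auto simp: W_iff)
    then show ?thesis using V H_not_V[of a s] VE_edge[OF e V] VE_from_sink[OF "3.prems"(2)] \<open>p = []\<close> VE_irrefl
      by (auto simp: above_def vform_def)
  next
    case False
    then have b: "b \<in> W" using edge_V[OF e] no_edge_into_source[OF e] by (auto simp: W_iff)
    note IH = "3.IH"(2)[OF p "3.prems"(2) b "3.prems"(4)]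
    show ?thesis
    proof (cases "is_H pos a b")
      case True
      then show ?thesis using IH hform_edge[OF e True, of w] b "3.prems" dist
        by (auto simp: form_def)
    next
      case False
      then have V: "is_V pos a b" using edge_HV[OF e] by auto
      then show ?thesis using IH vform_edge[OF e V, of w] b "3.prems" dist False by auto
    qed
  qed
qed (auto simp: is_path_def)

text \<open>\<open>above s\<close> does not change along a V-edge that does not end in a sink. Only
  the last edge disturbs the telescoping, and the vertex before \<open>t\<close> has value 1 exactly
  if \<open>t = s\<close>.\<close>

lemma hsum_above:
  assumes "is_path E p u t" "t \<in> sinks" "s \<in> sinks" "u \<notin> sinks"
  shows "hsum pos (above s) p = of_bool (t = s) - above s u"
  using assms
proof (induction p arbitrary: u rule: induct_list012)
  case (2 u)
  then show ?case by (auto simp: is_path_def)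
next
  case (3 a b p)
  have [simp]: "u = a" and e: "(a, b) \<in> E" and p: "is_path E (b # p) b t"
    using "3.prems"(1) by (auto simp: is_path_Cons_Cons)
  show ?case
  proof (cases "b \<in> sinks")
    case True
    then have V: "is_V pos a b" using sink_V[OF e] by auto
    have "p = []" using p no_edge_from_sink[of b] True by (cases p) (auto simp: is_path_Cons_Cons)
    then have [simp]: "b = t" using p by (auto simp: is_path_def)
    then show ?thesis using V H_not_V[of a t] VE_edge(2)[OF e V, of s] VE_from_sink[OF "3.prems"(2)] \<open>p = []\<close>
      by (auto simp: above_def)
  next
    case False
    note IH = "3.IH"(2)[OF p "3.prems"(2,3) False]
    show ?thesis
    proof (cases "is_H pos a b")
      case True
      then show ?thesis using IH by auto
    next
      case notH: False
      then have V: "is_V pos a b" using edge_HV[OF e] by auto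
      then show ?thesis using IH VE_edge(2)[OF e V, of s] "3.prems" notH False by (auto simp: above_def)
    qed
  qed
qed (auto simp: is_path_def)

lemma hsum_cong_sinks:
  assumes "epath p" "\<And>w. w \<in> set p \<Longrightarrow> w \<notin> sinks \<Longrightarrow> f w = g w"
  shows "hsum pos f p = hsum pos g p"
  using assms
proof (induction p rule: induct_list012)
  case (3 u v p)
  have "is_H pos u v \<Longrightarrow> f v = g v \<and> f u = g u"
    using sink_V[of u v] H_not_V[of u v] 3 by auto
  then show ?case using 3 by auto
qed auto

text \<open>By bilinearity this is the exponent of \<open>q\<close> picked up when the weights of
  the two paths are interchanged; the algebra itself enters only in
  \<open>qcomm_paths\<close>.\<close>

definition Form :: "'v list \<Rightarrow> 'v list \<Rightarrow> int" where
  "Form p p' = hsum pos (\<lambda>w. hsum pos (\<lambda>u. form u w) p) p'"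

lemma Form_split: "Form p (as @ v # bs) = Form p (as @ [v]) + Form p (v # bs)"
  unfolding Form_def by (rule hsum_split)

lemma Form_self: "Form p p = 0"
  unfolding Form_def by (rule hsum_antisym) (rule form_antisym)

lemma path_source_notin:
  assumes "is_path E p v s" "v \<notin> sources" 
  shows "set p \<inter> sources = {}"
  using assms
proof (induction p arbitrary: v rule: induct_list012)
  case (3 a b p)
  then show ?case using no_edge_into_source[of a b] by (auto simp: is_path_Cons_Cons)
qed (auto simp: is_path_def)

lemma Form_tails_diff:
  assumes A: "is_path E A v s" "s \<in> sinks" and B: "is_path E B v t" "t \<in> sinks" and v: "v \<in> W"
    and R: "is_path E R u t'" "u \<in> sources" "t' \<in> sinks"
  shows "Form A R - Form B R = of_bool (t' = s) - of_bool (t' = t) +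
    2 * (hsum pos (\<lambda>w. of_bool (w \<in> set B)) R - hsum pos (\<lambda>w. of_bool (w \<in> set A)) R)"
proof -
  have eR: "epath R" and RV: "set R \<subseteq> V"
    using R path_V[OF R(1)] sources_V by (auto simp: is_path_successively)
  have u: "u \<notin> sinks" using R(2) sources_sinks by blast
  have nA: "set A \<inter> sources = {}" and nB: "set B \<inter> sources = {}"
    using path_source_notin[OF A(1)] path_source_notin[OF B(1)] v by (auto simp: W_iff)
  have "Form A R - Form B R =
    hsum pos (\<lambda>w. hsum pos (\<lambda>u. form u w) A - hsum pos (\<lambda>u. form u w) B) R"
    by (simp add: Form_def hsum_diff)
  also have "\<dots> = hsum pos (\<lambda>w. (above s w - above t w) +
    2 * (of_bool (w \<in> set B) - of_bool (w \<in> set A))) R"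
  proof (rule hsum_cong_sinks[OF eR])
    fix w assume w: "w \<in> set R" "w \<notin> sinks"
    show "hsum pos (\<lambda>u. form u w) A - hsum pos (\<lambda>u. form u w) B = (above s w - above t w) +
      2 * (of_bool (w \<in> set B) - of_bool (w \<in> set A))"
    proof (cases "w \<in> sources")
      \<comment> \<open>The tail formula does not cover sources, but both sides vanish: no vertical
        edge leaves a source and the tails contain none.\<close>
      case True
      then have "form u w = 0" for u by (auto simp: form_def W_iff)
      then show ?thesis using True nA nB VE_from_source[OF True]
        by (auto simp: hsum_const above_def)
    next
      case False
      then have "w \<in> W" using w RV by (auto simp: W_iff)
      then show ?thesis using hsum_form_tail[OF A v] hsum_form_tail[OF B v] by auto
    qed
  qed
  also have "\<dots> = (hsum pos (above s) R - hsum pos (above t) R) +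
    2 * (hsum pos (\<lambda>w. of_bool (w \<in> set B)) R - hsum pos (\<lambda>w. of_bool (w \<in> set A)) R)"
    by (simp only: hsum_add hsum_mult hsum_diff)
  also have "hsum pos (above s) R - hsum pos (above t) R = of_bool (t' = s) - of_bool (t' = t)"
    using hsum_above[OF R(1,3) A(2) u] hsum_above[OF R(1,3) B(2) u] VE_from_source[OF R(2)]
    by (simp add: above_def)
  finally show ?thesis .
qed

lemma Form_tails_disjoint:
  assumes A: "is_path E A v s" "s \<in> sinks" and B: "is_path E B v t" "t \<in> sinks" and v: "v \<in> W"
    and R: "is_path E R u t'" "u \<in> sources" "t' \<in> sinks"
    and disj: "set R \<inter> (set A \<union> set B) = {}"
  shows "Form A R = Form B R"
proof -
  have "t' \<noteq> s" "t' \<noteq> t" using disj is_path_ends[OF A(1)] is_path_ends[OF B(1)] is_path_ends[OF R(1)] by auto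
  moreover have "hsum pos (\<lambda>w. of_bool (w \<in> set B) :: int) R = 0" "hsum pos (\<lambda>w. of_bool (w \<in> set A) :: int) R = 0"
    using disj by (auto intro!: hsum_const)
  ultimately show ?thesis using Form_tails_diff[OF A B v R] by auto
qed

text \<open>These three exponents remain when the two tails change places across the prefix
  \<open>bs @ [v]\<close>. They add up to a pairing with the complete path
  \<open>bs @ v # b # B\<close>, because the pairing of its tail with itself vanishes by skew
  symmetry.\<close>

lemma Form_tails_branching:
  assumes A: "is_path E (v # A) v s" "s \<in> sinks" and B: "is_path E (v # b # B) v t" "t \<in> sinks"
    and v: "v \<in> W" and b: "is_H pos v b"
    and R: "is_path E (bs @ [v]) u v" "u \<in> sources"
    and disj: "set (v # A) \<inter> set (v # b # B) = {v}"
  shows "Form (v # A) (bs @ [v]) + Form (v # A) (v # b # B) - Form (v # b # B) (bs @ [v]) = 1"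
proof -
  have Q: "is_path E (bs @ v # b # B) u t"
    using R(1) B(1) by (intro is_path_split[THEN iffD2]) auto
  have tne: "t \<noteq> s"
  proof
    assume "t = s"
    then have "s \<in> {v}" using is_path_ends[OF A(1)] is_path_ends[OF B(1)] disj by auto
    then show False using v A(2) by (auto simp: W_iff)
  qed
  have "sorted_wrt (\<lambda>a b. D a < D b) (bs @ v # b # B)" using Q epath_diag is_path_successively by metis
  then have Db: "\<And>w. w \<in> set bs \<Longrightarrow> D w < D v" by (auto simp: sorted_wrt_append)
  have bs: "w \<notin> set (v # A)" "w \<notin> set (v # b # B)" if "w \<in> set bs" for w
    using path_bounds(5)[OF A(1), of w] path_bounds(5)[OF B(1), of w] Db[OF that] by auto
  have bA: "w \<notin> set (v # A)" if "w \<in> set (b # B)" for w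
    using that disj epath_Cons_notin[of v "b # B"] B(1) by (auto simp: is_path_successively)
  have 1: "hsum pos (\<lambda>w. of_bool (w \<in> set (v # b # B)) :: int) (bs @ [v]) =
    hsum pos (\<lambda>w. of_bool (w \<in> set (v # A))) (bs @ [v])"
    using bs by (intro hsum_cong) auto
  have 2: "hsum pos (\<lambda>w. of_bool (w \<in> set (v # b # B)) :: int) (v # b # B) = 0"
    by (rule hsum_const[where a = 1]) auto
  have "hsum pos (\<lambda>w. of_bool (w \<in> set (v # A)) :: int) (b # B) = 0"
    using bA by (intro hsum_const[where a = 0]) auto
  then have 3: "hsum pos (\<lambda>w. of_bool (w \<in> set (v # A)) :: int) (v # b # B) = - 1"
    using b bA[of b] by auto
  \<comment> \<open>The sinks contribute -1. The indicator of \<open>v # A\<close> drops from 1 to 0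
    on the H-edge from \<open>v\<close> to \<open>b\<close>, and with the factor 2 this contributes
    +2.\<close>
  have "Form (v # A) (bs @ v # b # B) - Form (v # b # B) (bs @ v # b # B) = 1"
    unfolding Form_tails_diff[OF A B v Q R(2) B(2)] hsum_split[of pos _ bs v "b # B"] 1 2 3
    using tne by auto
  then show ?thesis unfolding Form_split[of _ bs v "b # B"] Form_self by auto
qed

end

section \<open>Commutation of path weights\<close>

lemma path_weight_Nil: "path_weight pos m r x xinv [] = 1"
  and path_weight_single: "path_weight pos m r x xinv [u] = 1"
  by (auto simp: path_weight_def)

lemma path_weight_Cons_Cons:
  "path_weight pos m r x xinv (u # v # p) =
    edge_weight pos m r x xinv u v * path_weight pos m r x xinv (v # p)"
proof -
  have "[0..<Suc (length p)] = 0 # map Suc [0..<length p]"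
    by (simp add: upt_conv_Cons map_Suc_upt del: upt_Suc)
  then show ?thesis unfolding path_weight_def by (simp add: o_def del: upt_Suc)
qed

lemma path_weight_split:
  "path_weight pos m r x xinv (as @ v # bs) =
    path_weight pos m r x xinv (as @ [v]) * path_weight pos m r x xinv (v # bs)"
proof (induction as)
  case (Cons a as)
  then show ?case by (cases as) (auto simp: path_weight_Cons_Cons path_weight_single mult.assoc)
qed (auto simp: path_weight_single)

locale se_algebra = se V E pos m n r c
  for V :: "'v set" and E :: "('v \<times> 'v) set" and pos :: "'v \<Rightarrow> real \<times> real"
    and m n :: nat and r c :: "nat \<Rightarrow> 'v" +
  fixes q :: "'k::field" and emb :: "'k \<Rightarrow> 'a::ring_1" and x xinv :: "'v \<Rightarrow> 'a"
  assumes q: "q \<noteq> 0"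
    and emb_1: "emb 1 = 1"
    and emb_add: "\<And>a b. emb (a + b) = emb a + emb b"
    and emb_mult: "\<And>a b. emb (a * b) = emb a * emb b"
    and emb_central: "\<And>a z. emb a * z = z * emb a"
    and inv: "\<And>w. w \<in> inner_vertices V m n r c \<Longrightarrow> x w * xinv w = 1 \<and> xinv w * x w = 1"
    and relH: "\<And>u v. u \<in> inner_vertices V m n r c \<Longrightarrow> v \<in> inner_vertices V m n r c \<Longrightarrow>
                 u \<noteq> v \<Longrightarrow> hpath E pos u v \<Longrightarrow> x u * x v = emb q * x v * x u"
    and relV: "\<And>u v. u \<in> inner_vertices V m n r c \<Longrightarrow> v \<in> inner_vertices V m n r c \<Longrightarrow>
                 u \<noteq> v \<Longrightarrow> vpath E pos u v \<Longrightarrow> x v * x u = emb q * x u * x v"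
    and relC: "\<And>u v. u \<in> inner_vertices V m n r c \<Longrightarrow> v \<in> inner_vertices V m n r c \<Longrightarrow>
                 u \<noteq> v \<Longrightarrow> \<not> hpath E pos u v \<Longrightarrow> \<not> hpath E pos v u \<Longrightarrow>
                 \<not> vpath E pos u v \<Longrightarrow> \<not> vpath E pos v u \<Longrightarrow> x u * x v = x v * x u"
begin

definition qcomm :: "int \<Rightarrow> 'a \<Rightarrow> 'a \<Rightarrow> bool" where
  "qcomm k a b \<longleftrightarrow> a * b = emb (q powi k) * (b * a)"

lemma emb_powi_add: "emb (q powi (k + l)) = emb (q powi k) * emb (q powi l)"
  using q by (simp add: power_int_add emb_mult)

lemma emb_powi_cancel: "emb (q powi k) * (emb (q powi (- k)) * z) = z"
  using emb_powi_add[of k "- k"] by (simp add: emb_1 mult.assoc[symmetric])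

lemma emb_left_commute: "z * (emb a * y) = emb a * (z * y)"
  using emb_central[of a z] by (metis mult.assoc)

lemma qcomm_1: "qcomm 0 a 1" "qcomm 0 1 a" and qcomm_refl: "qcomm 0 a a"
  by (auto simp: qcomm_def emb_1)

lemma qcomm_sym: "qcomm k a b \<Longrightarrow> qcomm (- k) b a"
  unfolding qcomm_def using emb_powi_cancel[of "- k" "b * a"] by simp

lemma qcomm_mult_right:
  assumes "qcomm k a b" "qcomm l a b'"
  shows "qcomm (k + l) a (b * b')"
proof -
  have "a * (b * b') = emb (q powi k) * (b * (a * b'))"
    using assms(1) unfolding qcomm_def by (metis mult.assoc)
  also have "a * b' = emb (q powi l) * (b' * a)" using assms(2) unfolding qcomm_def .
  also have "b * (emb (q powi l) * (b' * a)) = emb (q powi l) * (b * (b' * a))"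
    by (rule emb_left_commute)
  finally show ?thesis unfolding qcomm_def emb_powi_add by (simp add: mult.assoc)
qed

lemma qcomm_mult_left: "qcomm k a b \<Longrightarrow> qcomm l a' b \<Longrightarrow> qcomm (k + l) (a * a') b"
  using qcomm_mult_right[of "- k" b a "- l" a'] qcomm_sym[of k a b] qcomm_sym[of l a' b]
    qcomm_sym[of "- k + - l" b "a * a'"] by (simp add: add.commute)

lemma qcomm_inv_right:
  assumes "qcomm k a b" "b * bi = 1" "bi * b = 1"
  shows "qcomm (- k) a bi"
proof -
  have "a * bi = bi * (b * a) * bi" using assms(3) by (simp add: mult.assoc[symmetric])
  also have "b * a = emb (q powi (- k)) * (a * b)" using qcomm_sym[OF assms(1)] unfolding qcomm_def .
  also have "bi * (emb (q powi (- k)) * (a * b)) * bi = emb (q powi (- k)) * (bi * a * (b * bi))"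
    by (simp add: emb_left_commute mult.assoc)
  finally show ?thesis using assms(2) by (simp add: qcomm_def)
qed

lemma qcomm_inv_left:
  assumes "qcomm k a b" "a * ai = 1" "ai * a = 1"
  shows "qcomm (- k) ai b"
  using qcomm_sym[OF qcomm_inv_right[OF qcomm_sym[OF assms(1)] assms(2,3)]] by simp

lemma qcomm_prod_list:
  "(\<And>z. z \<in> set zs \<Longrightarrow> qcomm (k z) a (f z)) \<Longrightarrow>
    qcomm (sum_list (map k zs)) a (prod_list (map f zs))"
  by (induction zs) (auto simp: qcomm_1 qcomm_mult_right)

text \<open>\<open>u\<close> moves to the right past \<open>z\<close> and \<open>w\<close>; then
  \<open>w\<close> moves to the left past \<open>z\<close>, and this opposite direction accounts for
  the sign of \<open>b\<close>.\<close>

lemma qcomm_swap: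
  assumes "qcomm a u z" "qcomm b w z" "qcomm l u w"
  shows "u * (z * w) = emb (q powi (a + l - b)) * (w * (z * u))"
proof -
  have "u * (z * w) = emb (q powi (a + l)) * (z * w * u)"
    using qcomm_mult_right[OF assms(1,3)] unfolding qcomm_def by (simp add: mult.assoc)
  also have "z * w * u = emb (q powi (- b)) * (w * z) * u"
    using qcomm_sym[OF assms(2)] unfolding qcomm_def by simp
  finally show ?thesis using emb_powi_add[of "a + l" "- b"] by (simp add: mult.assoc)
qed

abbreviation "pw \<equiv> path_weight pos m r x xinv"

text \<open>Reading sources as \<open>1\<close> makes \<open>yinv u * y v\<close> the weight of every H-edge \<open>(u, v)\<close>.\<close>

definition "y u = (if u \<in> sources then 1 else x u)"
definition "yinv u = (if u \<in> sources then 1 else xinv u)"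

lemma edge_weight_edge:
  assumes "(u, v) \<in> E"
  shows "edge_weight pos m r x xinv u v = (if is_H pos u v then yinv u * y v else 1)"
  using source_H[OF assms] no_edge_into_source[OF assms]
  by (auto simp: edge_weight_def y_def yinv_def)

lemma y_inv: "u \<in> V \<Longrightarrow> u \<notin> sinks \<Longrightarrow> y u * yinv u = 1 \<and> yinv u * y u = 1"
  using inv[of u] by (auto simp: y_def yinv_def W_iff)

text \<open>The positions of the vertices make the four path relations mutually exclusive, so
  \<open>form\<close> is 1 or -1 whenever one of them holds. A source is read as \<open>1\<close>
  and commutes with everything, in agreement with the value 0.\<close>

lemma y_qcomm:
  assumes "u \<in> V" "u \<notin> sinks" "w \<in> V" "w \<notin> sinks"
  shows "qcomm (form u w) (y u) (y w)"
proof (cases "u \<in> W \<and> w \<in> W \<and> u \<noteq> w")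
  case False
  then show ?thesis using assms HE_irrefl VE_irrefl
    by (auto simp: form_def W_iff y_def qcomm_1 qcomm_refl hform_def vform_def)
next
  case True
  then have y: "y u = x u" "y w = x w" by (auto simp: y_def W_iff)
  consider "(u, w) \<in> HE\<^sup>+" | "(w, u) \<in> HE\<^sup>+" | "(u, w) \<in> VE\<^sup>+" | "(w, u) \<in> VE\<^sup>+"
    | "(u, w) \<notin> HE\<^sup>+" "(w, u) \<notin> HE\<^sup>+" "(u, w) \<notin> VE\<^sup>+" "(w, u) \<notin> VE\<^sup>+" by blast
  then show ?thesis
  proof cases
    case 1
    then have "form u w = 1" using True HE_trancl[OF 1] HE_trancl[of w u] VE_trancl[of u w] VE_trancl[of w u]
      by (auto simp: form_def hform_def vform_def is_H_def is_V_def)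
    then show ?thesis using relH[of u w] True 1 by (auto simp: y qcomm_def hpath_iff mult.assoc)
  next
    case 2
    then have "form w u = 1" using True HE_trancl[OF 2] HE_trancl[of u w] VE_trancl[of u w] VE_trancl[of w u]
      by (auto simp: form_def hform_def vform_def is_H_def is_V_def)
    moreover have "qcomm 1 (x w) (x u)" using relH[of w u] True 2 by (auto simp: qcomm_def hpath_iff mult.assoc)
    ultimately show ?thesis using qcomm_sym[of 1 "x w" "x u"] form_antisym[of u w] by (simp add: y)
  next
    case 3
    then have "form w u = 1" using True VE_trancl[OF 3] VE_trancl[of w u] HE_trancl[of u w] HE_trancl[of w u]
      by (auto simp: form_def hform_def vform_def is_H_def is_V_def)
    moreover have "qcomm 1 (x w) (x u)" using relV[of u w] True 3 by (auto simp: qcomm_def vpath_iff mult.assoc)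
    ultimately show ?thesis using qcomm_sym[of 1 "x w" "x u"] form_antisym[of u w] by (simp add: y)
  next
    case 4
    then have "form u w = 1" using True VE_trancl[OF 4] VE_trancl[of u w] HE_trancl[of u w] HE_trancl[of w u]
      by (auto simp: form_def hform_def vform_def is_H_def is_V_def)
    then show ?thesis using relV[of w u] True 4 by (auto simp: y qcomm_def vpath_iff mult.assoc)
  next
    case 5
    then have "form u w = 0" by (auto simp: form_def hform_def vform_def)
    then show ?thesis using relC[of u w] True 5 by (auto simp: y qcomm_def hpath_iff vpath_iff emb_1)
  qed
qed

lemma H_edge_inner:
  assumes "(u, v) \<in> E" "is_H pos u v"
  shows "u \<in> V" "v \<in> V" "u \<notin> sinks" "v \<notin> sinks"
  using edge_V[OF assms(1)] sink_V[OF assms(1)] H_not_V[OF assms(2)] by auto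

lemma qcomm_edge_right:
  assumes "(u, v) \<in> E" "\<And>w. w \<in> V \<Longrightarrow> w \<notin> sinks \<Longrightarrow> qcomm (k w) a (y w)"
  shows "qcomm (if is_H pos u v then k v - k u else 0) a (edge_weight pos m r x xinv u v)"
proof (cases "is_H pos u v")
  case True
  note i = H_edge_inner[OF assms(1) True]
  have "qcomm (- k u) a (yinv u)"
    using qcomm_inv_right[OF assms(2)[of u]] y_inv[of u] i by auto
  from qcomm_mult_right[OF this assms(2)[of v]] show ?thesis
    using i True by (auto simp: edge_weight_edge[OF assms(1)])
qed (auto simp: edge_weight_edge[OF assms(1)] qcomm_1)

lemma qcomm_edge_left:
  assumes "(u, v) \<in> E" "\<And>w. w \<in> V \<Longrightarrow> w \<notin> sinks \<Longrightarrow> qcomm (k w) (y w) a"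
  shows "qcomm (if is_H pos u v then k v - k u else 0) (edge_weight pos m r x xinv u v) a"
proof (cases "is_H pos u v")
  case True
  note i = H_edge_inner[OF assms(1) True]
  have "qcomm (- k u) (yinv u) a"
    using qcomm_inv_left[OF assms(2)[of u]] y_inv[of u] i by auto
  from qcomm_mult_left[OF this assms(2)[of v]] show ?thesis
    using i True by (auto simp: edge_weight_edge[OF assms(1)])
qed (auto simp: edge_weight_edge[OF assms(1)] qcomm_1)

lemma qcomm_path_right:
  assumes "epath p" "\<And>w. w \<in> V \<Longrightarrow> w \<notin> sinks \<Longrightarrow> qcomm (k w) a (y w)"
  shows "qcomm (hsum pos k p) a (pw p)"
  using assms(1)
proof (induction p rule: induct_list012)
  case (3 u v p)
  then have "qcomm (if is_H pos u v then k v - k u else 0) a (edge_weight pos m r x xinv u v)"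
    by (intro qcomm_edge_right assms) auto
  from qcomm_mult_right[OF this] 3 show ?case by (auto simp: path_weight_Cons_Cons)
qed (auto simp: qcomm_1 path_weight_single path_weight_Nil)

lemma qcomm_path_left:
  assumes "epath p" "\<And>w. w \<in> V \<Longrightarrow> w \<notin> sinks \<Longrightarrow> qcomm (k w) (y w) a"
  shows "qcomm (hsum pos k p) (pw p) a"
  using assms(1)
proof (induction p rule: induct_list012)
  case (3 u v p)
  then have "qcomm (if is_H pos u v then k v - k u else 0) (edge_weight pos m r x xinv u v) a"
    by (intro qcomm_edge_left assms) auto
  from qcomm_mult_left[OF this] 3 show ?case by (auto simp: path_weight_Cons_Cons)
qed (auto simp: qcomm_1 path_weight_single path_weight_Nil)

lemma qcomm_paths: "epath p \<Longrightarrow> epath p' \<Longrightarrow> qcomm (Form p p') (pw p) (pw p')"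
  unfolding Form_def by (intro qcomm_path_right qcomm_path_left y_qcomm)

text \<open>The prefix \<open>as\<close> remains a left factor. The weights of \<open>Rs\<close> and
  of the prefix of the second path form the middle factor in \<open>qcomm_swap\<close>; the paths in
  \<open>Rs\<close> contribute the same exponent to both tails and cancel.\<close>

lemma weight_swap_tails:
  assumes A: "is_path E (v # A) v s" "s \<in> sinks" and B: "is_path E (v # b # B) v t" "t \<in> sinks"
    and v: "v \<in> W" and b: "is_H pos v b"
    and R: "is_path E (bs @ [v]) u v" "u \<in> sources"
    and disj: "set (v # A) \<inter> set (v # b # B) = {v}"
    and Rs: "\<And>R. R \<in> set Rs \<Longrightarrow> \<exists>u'\<in>sources. \<exists>t'\<in>sinks. is_path E R u' t'"
      "\<And>R. R \<in> set Rs \<Longrightarrow> set R \<inter> (set (v # A) \<union> set (v # b # B)) = {}"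
  shows "pw (as @ v # A) * (prod_list (map pw Rs) * pw (bs @ v # b # B)) =
    emb q * (pw (as @ v # b # B) * (prod_list (map pw Rs) * pw (bs @ v # A)))"
proof -
  let ?A = "v # A" and ?B = "v # b # B" and ?b = "bs @ [v]"
  let ?M = "prod_list (map pw Rs)"
  have e: "epath ?A" "epath ?B" "epath ?b" "\<And>R. R \<in> set Rs \<Longrightarrow> epath R"
    using A(1) B(1) R(1) Rs(1) unfolding is_path_successively by blast+
  have qA: "qcomm (sum_list (map (Form ?A) Rs) + Form ?A ?b) (pw ?A) (?M * pw ?b)"
    and qB: "qcomm (sum_list (map (Form ?B) Rs) + Form ?B ?b) (pw ?B) (?M * pw ?b)"
    using e by (auto intro!: qcomm_mult_right qcomm_prod_list qcomm_paths)
  have "Form ?A R = Form ?B R" if "R \<in> set Rs" for R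
    using Rs(1)[OF that] Form_tails_disjoint[OF A B v _ _ _ Rs(2)[OF that]] by blast
  then have eqF: "map (Form ?A) Rs = map (Form ?B) Rs" by simp
  have "sum_list (map (Form ?A) Rs) + Form ?A ?b + Form ?A ?B - (sum_list (map (Form ?B) Rs) + Form ?B ?b) = 1"
    unfolding eqF using Form_tails_branching[OF A B v b R disj] by linarith
  with qcomm_swap[OF qA qB qcomm_paths[OF e(1,2)]]
  have "pw ?A * (?M * pw ?b * pw ?B) = emb q * (pw ?B * (?M * pw ?b * pw ?A))" by simp
  then have *: "pw ?A * (?M * (pw ?b * pw ?B)) = emb q * (pw ?B * (?M * (pw ?b * pw ?A)))"
    by (simp add: mult.assoc)
  show ?thesis
    unfolding path_weight_split[of pos m r x xinv as v A] path_weight_split[of pos m r x xinv bs v A]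
      path_weight_split[of pos m r x xinv as v "b # B"] path_weight_split[of pos m r x xinv bs v "b # B"]
    using * by (simp add: mult.assoc emb_left_commute)
qed

end

section \<open>Exchanging tails\<close>

text \<open>Distributivity for an ordered product: choices are recorded as lists, so that the order
  of the factors survives.\<close>

lemma prod_list_sum:
  fixes f :: "'b \<Rightarrow> 'a::ring_1"
  assumes "\<And>t. t < k \<Longrightarrow> finite (S t)"
  shows "prod_list (map (\<lambda>t. sum f (S t)) [0..<k]) =
    (\<Sum>P\<in>{P. length P = k \<and> (\<forall>t<k. P ! t \<in> S t)}. prod_list (map f P))"
  using assms
proof (induction k)
  case 0
  have "{P. length P = 0 \<and> (\<forall>t<0. P ! t \<in> S t)} = {[]}" by auto
  then show ?case by simp
next
  case (Suc k)
  let ?X = "{P. length P = k \<and> (\<forall>t<k. P ! t \<in> S t)}"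
  have eq: "{P. length P = Suc k \<and> (\<forall>t<Suc k. P ! t \<in> S t)} = (\<lambda>(P, p). P @ [p]) ` (?X \<times> S k)"
  proof (intro set_eqI iffI)
    fix P assume "P \<in> {P. length P = Suc k \<and> (\<forall>t<Suc k. P ! t \<in> S t)}"
    then have P: "length P = Suc k" "\<And>t. t < Suc k \<Longrightarrow> P ! t \<in> S t" by auto
    then obtain P' p where P': "P = P' @ [p]" "length P' = k" by (metis length_Suc_conv_rev)
    have "P' ! t \<in> S t" if "t < k" for t using P(2)[of t] that P' by (auto simp: nth_append)
    moreover have "p \<in> S k" using P(2)[of k] P' by (auto simp: nth_append)
    ultimately show "P \<in> (\<lambda>(P, p). P @ [p]) ` (?X \<times> S k)" using P' by force
  qed (auto simp: nth_append less_Suc_eq)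
  have "prod_list (map (\<lambda>t. sum f (S t)) [0..<Suc k]) = (\<Sum>P\<in>?X. prod_list (map f P)) * sum f (S k)"
    using Suc by simp
  also have "\<dots> = (\<Sum>(P, p)\<in>?X \<times> S k. prod_list (map f (P @ [p])))"
    by (simp add: sum_product sum.cartesian_product)
  also have "\<dots> = (\<Sum>P\<in>(\<lambda>(P, p). P @ [p]) ` (?X \<times> S k). prod_list (map f P))"
    by (subst sum.reindex) (auto simp: inj_on_def case_prod_unfold)
  finally show ?case unfolding eq .
qed

lemma list_update2_append:
  "(X @ a # Y @ b # Z)[length X := a', Suc (length X + length Y) := b'] = X @ a' # Y @ b' # Z"
  by (simp add: list_update_append)

lemma list_split2:
  assumes "s < t" "t < length xs"
  obtains X Y Z where "xs = X @ xs ! s # Y @ xs ! t # Z" "length X = s" "length Y = t - s - 1"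
proof -
  have "xs = take s xs @ xs ! s # drop (Suc s) xs" using assms by (simp add: id_take_nth_drop)
  moreover have "drop (Suc s) xs = take (t - Suc s) (drop (Suc s) xs) @ xs ! t # drop (Suc t) xs"
    using id_take_nth_drop[of "t - Suc s" "drop (Suc s) xs"] assms by simp
  ultimately show thesis using assms
    by (intro that[of "take s xs" "take (t - Suc s) (drop (Suc s) xs)" "drop (Suc t) xs"]) auto
qed

lemma takeWhile_neq: "v \<notin> set as \<Longrightarrow> takeWhile (\<lambda>w. w \<noteq> v) (as @ v # A) = as"
  by (induction as) auto

lemma dropWhile_neq: "v \<notin> set as \<Longrightarrow> dropWhile (\<lambda>w. w \<noteq> v) (as @ v # A) = v # A"
  by (induction as) auto

text \<open>Any third value compares alike with two consecutive values, so only the pair of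
  positions \<open>(s, t)\<close> changes its status.\<close>

lemma inversions_swap:
  assumes p: "\<sigma> permutes {..<k}" and st: "s < t" "t < k" and adj: "\<sigma> t = Suc (\<sigma> s)"
  shows "inversions (\<sigma> \<circ> Transposition.transpose s t) k = Suc (inversions \<sigma> k)"
proof -
  let ?S = "\<lambda>\<sigma>. {(a, b). a < b \<and> b < k \<and> \<sigma> b < (\<sigma> a :: nat)}"
  have inj: "\<sigma> u = \<sigma> w \<longleftrightarrow> u = w" for u w using permutes_inj[OF p] by (auto simp: inj_def)
  have st_ne: "\<sigma> u \<noteq> \<sigma> s" "\<sigma> u \<noteq> Suc (\<sigma> s)" if "u \<noteq> s" "u \<noteq> t" for u
    using inj[of u s] inj[of u t] that adj by auto
  have "?S (\<sigma> \<circ> Transposition.transpose s t) = insert (s, t) (?S \<sigma>)"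
  proof (intro set_eqI, clarify)
    fix a b
    show "(a, b) \<in> ?S (\<sigma> \<circ> Transposition.transpose s t) \<longleftrightarrow> (a, b) \<in> insert (s, t) (?S \<sigma>)"
      using st_ne[of a] st_ne[of b] adj st
      by (auto simp: Transposition.transpose_def not_less_eq less_Suc_eq)
  qed
  moreover have "finite (?S \<sigma>)"
    by (rule finite_subset[of _ "{..<k} \<times> {..<k}"]) auto
  moreover have "(s, t) \<notin> ?S \<sigma>" using adj by auto
  ultimately show ?thesis unfolding inversions_def by simp
qed

context se
begin

lemma finite_paths: "u \<in> V \<Longrightarrow> finite {p. is_path E p u v}"
  by (rule finite_subset[OF _ finite_subset_distinct[OF fin_V]])
    (auto simp: is_path_successively epath_distinct dest: subsetD[OF path_V, rotated 2])

lemma path_source_eq: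
  assumes "is_path E p u v" "w \<in> set p" "w \<in> sources"
  shows "w = u"
proof (cases p rule: remdups_adj.cases)
  case (3 a b p')
  then have "b \<notin> sources" "is_path E (b # p') b v" "u = a"
    using assms(1) no_edge_into_source[of a b] by (auto simp: is_path_Cons_Cons)
  then show ?thesis using path_source_notin[of "b # p'" b v] assms 3 by auto
qed (use assms in \<open>auto simp: is_path_def\<close>)

lemma path_sink_eq:
  assumes "is_path E p u v" "w \<in> set p" "w \<in> sinks"
  shows "w = v"
proof -
  obtain xs ys where p: "p = xs @ w # ys" using assms(2) split_list by metis
  have "is_path E (w # ys) w v" using assms(1) unfolding p by (rule is_path_split[THEN iffD1, THEN conjunct2])
  then show ?thesis using no_edge_from_sink[of w] assms(3)
    by (cases ys) (auto simp: is_path_Cons_Cons is_path_def[of _ "[_]"])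
qed

lemma path_split_diag:
  assumes "is_path E (as @ v # A) u w"
  shows "\<And>z. z \<in> set as \<Longrightarrow> D z < D v" "\<And>z. z \<in> set A \<Longrightarrow> D v < D z"
proof -
  have "sorted_wrt (\<lambda>a b. D a < D b) (as @ v # A)" using assms epath_diag is_path_successively by metis
  then show "\<And>z. z \<in> set as \<Longrightarrow> D z < D v" "\<And>z. z \<in> set A \<Longrightarrow> D v < D z"
    by (auto simp: sorted_wrt_append)
qed

end

locale se_minor = se_algebra V E pos m n r c q emb x xinv
  for V :: "'v set" and E :: "('v \<times> 'v) set" and pos :: "'v \<Rightarrow> real \<times> real"
    and m n :: nat and r c :: "nat \<Rightarrow> 'v"
    and q :: "'k::field" and emb :: "'k \<Rightarrow> 'a::ring_1" and x xinv :: "'v \<Rightarrow> 'a" +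
  fixes I J :: "nat set"
  assumes IJ: "I \<subseteq> {1..m}" "J \<subseteq> {1..n}" "card I = card J"
begin

section \<open>Systems of paths and their common vertices\<close>

abbreviation "k \<equiv> card I"
abbreviation "src t \<equiv> sorted_list_of_set I ! t"
abbreviation "snk t \<equiv> sorted_list_of_set J ! t"

lemma finite_IJ: "finite I" "finite J" using IJ finite_subset by blast+

lemma src_mem: "t < k \<Longrightarrow> src t \<in> {1..m}" and snk_mem: "t < k \<Longrightarrow> snk t \<in> J"
  and snk_mem': "t < k \<Longrightarrow> snk t \<in> {1..n}"
  using IJ finite_IJ nth_mem[of t "sorted_list_of_set I"] nth_mem[of t "sorted_list_of_set J"]
  by auto

lemma src_mono: "s < t \<Longrightarrow> t < k \<Longrightarrow> src s < src t" and snk_mono: "s < t \<Longrightarrow> t < k \<Longrightarrow> snk s < snk t"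
  using IJ(3) sorted_wrt_nth_less[of "(<)" "sorted_list_of_set I" s t]
    sorted_wrt_nth_less[of "(<)" "sorted_list_of_set J" s t] by simp_all

lemma snk_less_iff: "s < k \<Longrightarrow> t < k \<Longrightarrow> snk s < snk t \<longleftrightarrow> s < t"
  using snk_mono by (metis linorder_neqE_nat order_less_asym)

definition systems :: "(nat \<Rightarrow> nat) \<Rightarrow> 'v list list set" where
  "systems \<sigma> = {P. length P = k \<and> (\<forall>t<k. is_path E (P ! t) (r (src t)) (c (snk (\<sigma> t))))}"

definition shared :: "'v list list \<Rightarrow> 'v set" where
  "shared P = {w. \<exists>s<k. \<exists>t<k. s \<noteq> t \<and> w \<in> set (P ! s) \<and> w \<in> set (P ! t)}"

text \<open>
  \<open>pivot P\<close> depends only on the set \<open>shared P\<close>, which exchanging tails does not change; this is why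
  \<open>swap_tails\<close> is an involution.
\<close>

definition pivot :: "'v list list \<Rightarrow> 'v" where
  "pivot P = (SOME w. w \<in> shared P \<and> (\<forall>w'\<in>shared P. D w' \<le> D w))"

definition crossing :: "'v list list \<Rightarrow> nat set" where
  "crossing P = {u. u < k \<and> pivot P \<in> set (P ! u)}"

text \<open>A path visits a vertex at most once, so both list functions cut at the same place;
  \<open>v\<close> is kept with the tail.\<close>

definition splice_at :: "'v \<Rightarrow> 'v list \<Rightarrow> 'v list \<Rightarrow> 'v list" where
  "splice_at v p p' = takeWhile (\<lambda>w. w \<noteq> v) p @ dropWhile (\<lambda>w. w \<noteq> v) p'"

definition swap_tails :: "(nat \<Rightarrow> nat) \<times> 'v list list \<Rightarrow> (nat \<Rightarrow> nat) \<times> 'v list list" where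
  "swap_tails \<equiv> \<lambda>(\<sigma>, P). let v = pivot P; s = Min (crossing P); t = Max (crossing P) in
    (\<sigma> \<circ> Transposition.transpose s t, P[s := splice_at v (P ! s) (P ! t), t := splice_at v (P ! t) (P ! s)])"

lemma sharedI: "s < k \<Longrightarrow> t < k \<Longrightarrow> s \<noteq> t \<Longrightarrow> w \<in> set (P ! s) \<Longrightarrow> w \<in> set (P ! t) \<Longrightarrow> w \<in> shared P"
  by (auto simp: shared_def)

lemma systemsD:
  assumes "P \<in> systems \<sigma>"
  shows "length P = k" "\<And>t. t < k \<Longrightarrow> is_path E (P ! t) (r (src t)) (c (snk (\<sigma> t)))"
  using assms by (auto simp: systems_def)

lemma perm_less: "\<sigma> permutes {..<k} \<Longrightarrow> t < k \<Longrightarrow> \<sigma> t < k"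
  using permutes_in_image by fastforce

lemma system_V: "P \<in> systems \<sigma> \<Longrightarrow> t < k \<Longrightarrow> set (P ! t) \<subseteq> V"
  using path_V[OF systemsD(2)] sources_V src_mem by blast

lemma pivot:
  assumes "P \<in> systems \<sigma>" "shared P \<noteq> {}"
  shows "pivot P \<in> shared P" "\<And>w. w \<in> shared P \<Longrightarrow> D w \<le> D (pivot P)"
proof -
  have "shared P \<subseteq> V" using system_V[OF assms(1)] by (auto simp: shared_def)
  then have "finite (shared P)" using fin_V finite_subset by blast
  then have "\<exists>w. w \<in> shared P \<and> (\<forall>w'\<in>shared P. D w' \<le> D w)"
    using assms(2) Max_in[of "D ` shared P"] Max_ge[of "D ` shared P"] by fastforce
  from someI_ex[OF this, folded pivot_def]
  show "pivot P \<in> shared P" "\<And>w. w \<in> shared P \<Longrightarrow> D w \<le> D (pivot P)" by auto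
qed

text \<open>A path contains no source or sink besides its ends, and these differ for different paths
  of a system. Hence the pivot is a generator and has a next edge on each path through it.\<close>

lemma shared_inner:
  assumes "\<sigma> permutes {..<k}" "P \<in> systems \<sigma>" "w \<in> shared P"
  shows "w \<in> W"
proof -
  obtain s t where st: "s < k" "t < k" "s \<noteq> t" "w \<in> set (P ! s)" "w \<in> set (P ! t)"
    using assms(3) by (auto simp: shared_def)
  note p = systemsD(2)[OF assms(2)]
  have "w \<notin> sources"
  proof
    assume "w \<in> sources"
    then have "r (src s) = r (src t)"
      using path_source_eq[OF p[OF st(1)] st(4)] path_source_eq[OF p[OF st(2)] st(5)] by simp
    then have "src s = src t" using inj_r src_mem st by (meson inj_onD)
    then show False using src_mono[of s t] src_mono[of t s] st by linarith
  qed
  moreover have "w \<notin> sinks"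
  proof
    assume "w \<in> sinks"
    then have "c (snk (\<sigma> s)) = c (snk (\<sigma> t))"
      using path_sink_eq[OF p[OF st(1)] st(4)] path_sink_eq[OF p[OF st(2)] st(5)] by simp
    then have "snk (\<sigma> s) = snk (\<sigma> t)" using inj_c snk_mem' perm_less[OF assms(1)] st by (meson inj_onD)
    then have "\<sigma> s = \<sigma> t"
      using snk_mono[of "\<sigma> s" "\<sigma> t"] snk_mono[of "\<sigma> t" "\<sigma> s"] perm_less[OF assms(1)] st by (metis linorder_neqE_nat nat_neq_iff)
    then show False using permutes_inj[OF assms(1)] st by (auto simp: inj_def)
  qed
  ultimately show ?thesis using system_V[OF assms(2)] st by (auto simp: W_iff)
qed

lemma next_at_pivot:
  assumes "\<sigma> permutes {..<k}" "P \<in> systems \<sigma>" "v \<in> shared P" "u < k" "v \<in> set (P ! u)"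
  obtains as a A where "P ! u = as @ v # a # A" "(v, a) \<in> E"
proof -
  obtain as A' where p: "P ! u = as @ v # A'" using split_list[OF assms(5)] by blast
  have pa: "is_path E (v # A') v (c (snk (\<sigma> u)))"
    using systemsD(2)[OF assms(2,4)] unfolding p by (rule is_path_split[THEN iffD1, THEN conjunct2])
  have "c (snk (\<sigma> u)) \<in> sinks" using snk_mem' perm_less[OF assms(1,4)] by auto
  then have "A' \<noteq> []" using pa shared_inner[OF assms(1-3)] by (auto simp: is_path_def W_iff)
  then obtain a A where "A' = a # A" by (cases A') auto
  then show thesis using that p pa by (auto simp: is_path_Cons_Cons)
qed

text \<open>Two paths leaving the pivot by the same edge would share its end, where \<open>D\<close>
  is larger. At most one edge of each direction leaves a vertex, so there is no room for a third
  path.\<close>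

lemma crossing_pair:
  assumes \<sigma>: "\<sigma> permutes {..<k}" and P: "P \<in> systems \<sigma>" and ne: "shared P \<noteq> {}"
  obtains s t as a A bs b B where "s < t" "t < k" "crossing P = {s, t}"
    "P ! s = as @ pivot P # a # A" "P ! t = bs @ pivot P # b # B"
    "is_V pos (pivot P) a \<and> is_H pos (pivot P) b \<or> is_H pos (pivot P) a \<and> is_V pos (pivot P) b"
proof -
  define v where "v = pivot P"
  have v: "v \<in> shared P" "\<And>w. w \<in> shared P \<Longrightarrow> D w \<le> D v"
    using pivot[OF P ne] by (auto simp: v_def)
  obtain s t where st: "s < t" "t < k" "v \<in> set (P ! s)" "v \<in> set (P ! t)"
  proof -
    obtain s t where *: "s < k" "t < k" "s \<noteq> t" "v \<in> set (P ! s)" "v \<in> set (P ! t)"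
      using v(1) by (auto simp: shared_def)
    then show thesis using that[of s t] that[of t s] by (cases "s < t") auto
  qed
  have diff: "a \<noteq> b" if "P ! u = as @ v # a # A" "P ! u' = bs @ v # b # B" "(v, a) \<in> E" "u < k" "u' < k" "u \<noteq> u'"
    for u u' as a A bs b B
  proof
    assume "a = b"
    then have "a \<in> shared P" using that by (intro sharedI[of u u']) auto
    then show False using v(2)[of a] edge_diag[OF that(3)] by auto
  qed
  obtain as a A where a: "P ! s = as @ v # a # A" "(v, a) \<in> E"
    using next_at_pivot[OF \<sigma> P v(1) _ st(3)] st by auto
  obtain bs b B where b: "P ! t = bs @ v # b # B" "(v, b) \<in> E"
    using next_at_pivot[OF \<sigma> P v(1) _ st(4)] st by auto
  have "a \<noteq> b" using diff[OF a(1) b(1) a(2)] st by auto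
  then have HV: "is_V pos v a \<and> is_H pos v b \<or> is_H pos v a \<and> is_V pos v b"
    using edge_HV[OF a(2)] edge_HV[OF b(2)] H_out_unique[OF a(2) b(2)] V_out_unique[OF a(2) b(2)] by auto
  have "u = s \<or> u = t" if u: "u < k" "v \<in> set (P ! u)" for u
  proof (rule ccontr)
    assume n: "\<not> (u = s \<or> u = t)"
    obtain cs d C where d: "P ! u = cs @ v # d # C" "(v, d) \<in> E"
      using next_at_pivot[OF \<sigma> P v(1) u] by auto
    have "d \<noteq> a" "d \<noteq> b" using diff[OF d(1) a(1) d(2)] diff[OF d(1) b(1) d(2)] u st n by auto
    then show False using HV edge_HV[OF d(2)] H_out_unique[OF d(2) a(2)] H_out_unique[OF d(2) b(2)]
        V_out_unique[OF d(2) a(2)] V_out_unique[OF d(2) b(2)] by auto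
  qed
  then have "crossing P = {s, t}" using st by (auto simp: crossing_def v_def)
  then show thesis using that st a b HV by (auto simp: v_def)
qed

text \<open>How many of the paths \<open>s\<close> and \<open>t\<close> contain a vertex is
  determined by the union and the intersection of their vertex sets. The hypotheses are symmetric in
  \<open>P\<close> and \<open>P'\<close>, so this inclusion gives equality.\<close>

lemma shared_subset:
  assumes "s < k" "t < k" "s \<noteq> t" "\<And>u. u \<noteq> s \<Longrightarrow> u \<noteq> t \<Longrightarrow> P' ! u = P ! u"
    "set (P' ! s) \<union> set (P' ! t) = set (P ! s) \<union> set (P ! t)"
    "set (P' ! s) \<inter> set (P' ! t) = set (P ! s) \<inter> set (P ! t)"
  shows "shared P \<subseteq> shared P'"
proof
  fix w assume "w \<in> shared P"
  then obtain u u' where u: "u < k" "u' < k" "u \<noteq> u'" "w \<in> set (P ! u)" "w \<in> set (P ! u')"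
    by (auto simp: shared_def)
  have 1: "w \<in> shared P'" if "u \<noteq> s" "u \<noteq> t" "u' \<in> {s, t}" "u < k" "w \<in> set (P ! u)" "w \<in> set (P ! u')" for u u'
  proof -
    have "w \<in> set (P' ! u)" using that assms(4)[of u] by auto
    moreover have "w \<in> set (P' ! s) \<or> w \<in> set (P' ! t)" using that assms(5) by blast
    ultimately show ?thesis using that assms(1,2) unfolding shared_def by blast
  qed
  consider "u \<notin> {s, t}" "u' \<notin> {s, t}" | "u \<notin> {s, t}" "u' \<in> {s, t}" | "u \<in> {s, t}" "u' \<notin> {s, t}"
    | "u \<in> {s, t}" "u' \<in> {s, t}" by blast
  then show "w \<in> shared P'"
  proof cases
    case 1
    then show ?thesis using u assms(4)[of u] assms(4)[of u'] by (intro sharedI[of u u']) auto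
  next
    case 2
    then show ?thesis using 1[of u u'] u by auto
  next
    case 3
    then show ?thesis using 1[of u' u] u by auto
  next
    case 4
    then have "w \<in> set (P ! s) \<inter> set (P ! t)" using u by auto
    then show ?thesis using assms(1-3,6) unfolding shared_def by blast
  qed
qed

section \<open>The exchange as an involution that reverses signed weights\<close>

lemma swap_tails_eq:
  assumes "crossing P = {s, t}" "s < t" "v = pivot P" "P ! s = as @ v # A" "P ! t = bs @ v # B"
    "v \<notin> set as" "v \<notin> set bs"
  shows "swap_tails (\<sigma>, P) = (\<sigma> \<circ> Transposition.transpose s t, P[s := as @ v # B, t := bs @ v # A])"
proof -
  have "Min (crossing P) = s" "Max (crossing P) = t" using assms(1,2) by auto
  moreover have "splice_at v (as @ v # A) (bs @ v # B) = as @ v # B"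
    "splice_at v (bs @ v # B) (as @ v # A) = bs @ v # A"
    unfolding splice_at_def takeWhile_neq[OF assms(6)] takeWhile_neq[OF assms(7)]
      dropWhile_neq[OF assms(6)] dropWhile_neq[OF assms(7)] by simp_all
  ultimately show ?thesis using assms(3-5) by (simp add: swap_tails_def Let_def)
qed

lemma swap_tails_system:
  assumes \<sigma>: "\<sigma> permutes {..<k}" and P: "P \<in> systems \<sigma>" and ne: "shared P \<noteq> {}"
    and st: "s < t" "t < k" "crossing P = {s, t}"
    and v: "v = pivot P" "P ! s = as @ v # A" "P ! t = bs @ v # B"
    and \<sigma>': "\<sigma>' = \<sigma> \<circ> Transposition.transpose s t" and P': "P' = P[s := as @ v # B, t := bs @ v # A]"
  shows "swap_tails (\<sigma>, P) = (\<sigma>', P')" "\<sigma>' permutes {..<k}" "P' \<in> systems \<sigma>'"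
    "shared P' = shared P" "crossing P' = crossing P" "swap_tails (\<sigma>', P') = (\<sigma>, P)"
proof -
  note p = systemsD(2)[OF P]
  have len: "length P = k" using systemsD(1)[OF P] .
  have ps: "is_path E (as @ v # A) (r (src s)) (c (snk (\<sigma> s)))"
    and pt: "is_path E (bs @ v # B) (r (src t)) (c (snk (\<sigma> t)))"
    using p[of s] p[of t] st v by auto
  note ds = path_split_diag[OF ps] and dt = path_split_diag[OF pt]
  have nv: "v \<notin> set as" "v \<notin> set bs" using ds(1)[of v] dt(1)[of v] by auto
  show sw: "swap_tails (\<sigma>, P) = (\<sigma>', P')"
    unfolding \<sigma>' P' by (rule swap_tails_eq[OF st(3,1) v nv])
  show "\<sigma>' permutes {..<k}"
    unfolding \<sigma>' using st by (intro permutes_compose[OF _ \<sigma>] permutes_swap_id) auto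
  have nth: "P' ! s = as @ v # B" "P' ! t = bs @ v # A" "\<And>u. u \<noteq> s \<Longrightarrow> u \<noteq> t \<Longrightarrow> P' ! u = P ! u"
    using st len by (auto simp: P')
  note ss = ps[THEN is_path_split[THEN iffD1]] and tt = pt[THEN is_path_split[THEN iffD1]]
  have "is_path E (as @ v # B) (r (src s)) (c (snk (\<sigma> t)))" "is_path E (bs @ v # A) (r (src t)) (c (snk (\<sigma> s)))"
    using ss tt by (auto intro!: is_path_split[THEN iffD2])
  then have "is_path E (P' ! u) (r (src u)) (c (snk (\<sigma>' u)))" if "u < k" for u
    using p[OF that] nth st by (cases "u = s"; cases "u = t") (auto simp: \<sigma>')
  then show "P' \<in> systems \<sigma>'" using len by (auto simp: systems_def P')
  \<comment> \<open>Prefixes lie strictly before \<open>v\<close> and tails strictly after it with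
    respect to \<open>D\<close>. Recombining them therefore leaves the intersection of the two paths
    unchanged.\<close>
  have disj: "set as \<inter> set B = {}" "set bs \<inter> set A = {}" "set as \<inter> set A = {}" "set bs \<inter> set B = {}"
    using order_less_asym[OF ds(1) dt(2)] order_less_asym[OF dt(1) ds(2)]
      order_less_asym[OF ds(1) ds(2)] order_less_asym[OF dt(1) dt(2)] by blast+
  have un: "set (P' ! s) \<union> set (P' ! t) = set (P ! s) \<union> set (P ! t)"
    unfolding nth v by auto
  have int: "set (P' ! s) \<inter> set (P' ! t) = set (P ! s) \<inter> set (P ! t)"
    unfolding nth v(2,3) using disj by auto
  show sh: "shared P' = shared P"
    using st un int nth by (intro equalityI shared_subset[of s t]) auto
  then have piv: "pivot P' = pivot P" by (simp add: pivot_def)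
  show cr: "crossing P' = crossing P"
  proof -
    have "v \<in> set (P' ! u) \<longleftrightarrow> v \<in> set (P ! u)" for u
      by (cases "u = s \<or> u = t") (auto simp: nth v(2,3))
    then show ?thesis by (simp add: crossing_def piv v(1))
  qed
  have "swap_tails (\<sigma>', P') = (\<sigma>' \<circ> Transposition.transpose s t, P'[s := as @ v # A, t := bs @ v # B])"
    using st cr v piv nv nth by (intro swap_tails_eq) auto
  also have "\<sigma>' \<circ> Transposition.transpose s t = \<sigma>" by (simp add: \<sigma>' comp_assoc)
  also have "P'[s := as @ v # A, t := bs @ v # B] = P"
    using nth v st len by (intro nth_equalityI) (auto simp: P' nth_list_update)
  finally show "swap_tails (\<sigma>', P') = (\<sigma>, P)" .
qed

definition signed_weight :: "(nat \<Rightarrow> nat) \<times> 'v list list \<Rightarrow> 'a" where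
  "signed_weight \<equiv> \<lambda>(\<sigma>, P). emb ((- q) ^ inversions \<sigma> k) * prod_list (map pw P)"

lemma emb_uminus: "emb (- a) = - emb a"
proof -
  have "emb 0 = 0" using emb_add[of 0 0] by simp
  then show ?thesis using emb_add[of a "- a"] by (simp add: eq_neg_iff_add_eq_0 add.commute)
qed

text \<open>Only the member of a pair with fewer inversions is treated. This fixes which tail is
  vertical and hence which power of \<open>q\<close> appears; the other member is covered by the
  involution.\<close>

lemma swap_tails_weight:
  assumes \<sigma>: "\<sigma> permutes {..<k}" and P: "P \<in> systems \<sigma>" and ne: "shared P \<noteq> {}"
    and less: "\<sigma> (Min (crossing P)) < \<sigma> (Max (crossing P))"
  shows "signed_weight (swap_tails (\<sigma>, P)) = - signed_weight (\<sigma>, P)"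
proof -
  define v where "v = pivot P"
  have v: "v \<in> shared P" "\<And>w. w \<in> shared P \<Longrightarrow> D w \<le> D v"
    using pivot[OF P ne] by (auto simp: v_def)
  obtain s t as a A bs b B where st: "s < t" "t < k" "crossing P = {s, t}"
    and ab: "P ! s = as @ v # a # A" "P ! t = bs @ v # b # B"
    and HV: "is_V pos v a \<and> is_H pos v b \<or> is_H pos v a \<and> is_V pos v b"
    using crossing_pair[OF \<sigma> P ne] unfolding v_def by metis
  note p = systemsD(2)[OF P]
  have len: "length P = k" using systemsD(1)[OF P] .
  have less': "\<sigma> s < \<sigma> t" using less st by auto
  have sk: "s < k" using st by auto
  have \<sigma>k: "\<And>u. u < k \<Longrightarrow> \<sigma> u < k" using perm_less[OF \<sigma>] .
  have ps: "is_path E (as @ v # a # A) (r (src s)) (c (snk (\<sigma> s)))"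
    and pt: "is_path E (bs @ v # b # B) (r (src t)) (c (snk (\<sigma> t)))"
    using p[of s] p[of t] st ab by auto
  note ss = ps[THEN is_path_split[THEN iffD1]] and tt = pt[THEN is_path_split[THEN iffD1]]
  note mem = src_mem[OF sk] src_mem[OF st(2)] snk_mem'[OF \<sigma>k[OF sk]] snk_mem'[OF \<sigma>k[OF st(2)]]
  have common: "D w \<le> D v" if "w \<in> set (P ! s)" "w \<in> set (P ! t)" for w
    using v(2)[OF sharedI[of s t]] that st by auto
  have other: "D w < D v" if "u < k" "u \<noteq> s" "u \<noteq> t" "w \<in> set (P ! u)" "w \<in> set (P ! s) \<or> w \<in> set (P ! t)" for u w
  proof -
    have "v \<notin> set (P ! u)" using that st(3) unfolding crossing_def v_def by blast
    then have "w \<noteq> v" using that by auto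
    have w: "w \<in> shared P" using that st sharedI[of u s w P] sharedI[of u t w P] by auto
    then have "D w \<le> D v" by (rule v(2))
    \<comment> \<open>\<open>D\<close> is injective on each path, so \<open>v\<close> is the only
      vertex of the paths \<open>s\<close> and \<open>t\<close> on its line.\<close>
    moreover have "D w \<noteq> D v"
    proof
      assume "D w = D v"
      then have "w \<notin> set as" "w \<notin> set (a # A)" "w \<notin> set bs" "w \<notin> set (b # B)"
        using path_split_diag[OF ps] path_split_diag[OF pt] by fastforce+
      then show False using \<open>w \<noteq> v\<close> that ab by auto
    qed
    ultimately show ?thesis by auto
  qed
  have snk_less: "snk (\<sigma> u) < snk (\<sigma> u') \<longleftrightarrow> \<sigma> u < \<sigma> u'" if "u < k" "u' < k" for u u'
    using snk_less_iff[OF \<sigma>k \<sigma>k] that by auto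
  have ne_snk: "snk (\<sigma> s) \<noteq> snk (\<sigma> t)" using snk_less[OF sk st(2)] less' by auto
  \<comment> \<open>The vertical tail reaches the sink further to the left, and
    \<open>\<sigma> s < \<sigma> t\<close> says that this is the tail of path
    \<open>s\<close>.\<close>
  have H: "is_V pos v a" "is_H pos v b"
  proof -
    have "\<not> (is_H pos v a \<and> is_V pos v b)"
    proof
      assume *: "is_H pos v a \<and> is_V pos v b"
      have "snk (\<sigma> t) < snk (\<sigma> s)"
        using * common ab by (intro branching_sink_order[OF mem(2,1) mem(4,3) ne_snk[symmetric] pt ps]) auto
      then show False using snk_less[OF st(2) sk] less' by auto
    qed
    then show "is_V pos v a" "is_H pos v b" using HV by auto
  qed
  \<comment> \<open>A path with a value strictly in between would end at a sink between the two,
    although it meets neither path at \<open>v\<close> or later.\<close>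
  have adj: "\<sigma> t = Suc (\<sigma> s)"
  proof (rule ccontr)
    assume "\<sigma> t \<noteq> Suc (\<sigma> s)"
    then have lt: "Suc (\<sigma> s) < \<sigma> t" using less' by auto
    then have "Suc (\<sigma> s) \<in> {..<k}" using \<sigma>k[OF st(2)] by auto
    then obtain u where u: "u < k" "\<sigma> u = Suc (\<sigma> s)"
      using permutes_image[OF \<sigma>] by (metis imageE lessThan_iff)
    have "u \<noteq> s" "u \<noteq> t" using u lt by auto
    then have "\<not> (snk (\<sigma> s) < snk (\<sigma> u) \<and> snk (\<sigma> u) < snk (\<sigma> t))"
      using other[OF u(1)] ab snk_less[OF sk u(1)] snk_less[OF u(1) st(2)] u lt
      by (intro sink_not_between[OF mem(1,2) src_mem[OF u(1)] mem(3,4) snk_mem'[OF \<sigma>k[OF u(1)]] _ _ ps pt p[OF u(1)]]) auto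
    then show False using snk_less[OF sk u(1)] snk_less[OF u(1) st(2)] u lt by auto
  qed
  obtain X Y Z where XYZ: "P = X @ P ! s # Y @ P ! t # Z" "length X = s" "length Y = t - s - 1"
    using list_split2[of s t P] st len by metis
  have Y: "\<exists>u<k. u \<noteq> s \<and> u \<noteq> t \<and> R = P ! u" if RY: "R \<in> set Y" for R
  proof -
    obtain i where i: "i < length Y" "R = Y ! i" using RY by (auto simp: in_set_conv_nth)
    have "R = P ! (Suc s + i)" using i XYZ(2) by (subst XYZ(1)) (auto simp: nth_append)
    then show ?thesis using i XYZ(3) st by (intro exI[of _ "Suc s + i"]) auto
  qed
  define P' where "P' = P[s := as @ v # b # B, t := bs @ v # a # A]"
  have P'_eq: "P' = X @ (as @ v # b # B) # Y @ (bs @ v # a # A) # Z"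
    using list_update2_append[of X "P ! s" Y "P ! t" Z "as @ v # b # B" "bs @ v # a # A"] XYZ(2,3) st
    unfolding P'_def XYZ(1)[symmetric] by simp
  have swp: "swap_tails (\<sigma>, P) = (\<sigma> \<circ> Transposition.transpose s t, P')"
    using swap_tails_system(1)[OF \<sigma> P ne st v_def ab refl refl] by (simp add: P'_def)
  have "pw (as @ v # a # A) * (prod_list (map pw Y) * pw (bs @ v # b # B)) =
    emb q * (pw (as @ v # b # B) * (prod_list (map pw Y) * pw (bs @ v # a # A)))"
  proof (rule weight_swap_tails)
    show "is_path E (v # a # A) v (c (snk (\<sigma> s)))" "is_path E (v # b # B) v (c (snk (\<sigma> t)))"
      "is_path E (bs @ [v]) (r (src t)) v" using ss tt by auto
    show "c (snk (\<sigma> s)) \<in> sinks" "c (snk (\<sigma> t)) \<in> sinks" "r (src t) \<in> sources" using mem by auto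
    show "v \<in> W" using shared_inner[OF \<sigma> P v(1)] .
    show "is_H pos v b" by fact
    show "set (v # a # A) \<inter> set (v # b # B) = {v}"
    proof -
      have "w = v" if "w \<in> set (v # a # A)" "w \<in> set (v # b # B)" for w
        using common[of w] path_split_diag(2)[OF ps, of w] that ab by auto
      then show ?thesis by auto
    qed
  next
    fix R assume "R \<in> set Y"
    then obtain u where u: "u < k" "u \<noteq> s" "u \<noteq> t" "R = P ! u" using Y by blast
    show "\<exists>u'\<in>sources. \<exists>t'\<in>sinks. is_path E R u' t'"
      using p[OF u(1)] src_mem[OF u(1)] snk_mem'[OF \<sigma>k[OF u(1)]] u(4) by blast
    have "\<not> D w < D v" if "w \<in> set (v # a # A) \<union> set (v # b # B)" for w
      using path_split_diag(2)[OF ps, of w] path_split_diag(2)[OF pt, of w] that by auto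
    moreover have "D w < D v" if "w \<in> set R" "w \<in> set (v # a # A) \<union> set (v # b # B)" for w
      using other[OF u(1-3), of w] that u(4) ab by auto
    ultimately show "set R \<inter> (set (v # a # A) \<union> set (v # b # B)) = {}" by blast
  qed
  then have "prod_list (map pw X) * (pw (as @ v # a # A) * (prod_list (map pw Y) * pw (bs @ v # b # B))) * prod_list (map pw Z)
    = emb q * (prod_list (map pw X) * (pw (as @ v # b # B) * (prod_list (map pw Y) * pw (bs @ v # a # A))) * prod_list (map pw Z))"
    by (simp add: emb_left_commute mult.assoc)
  moreover have "prod_list (map pw P) =
    prod_list (map pw X) * (pw (as @ v # a # A) * (prod_list (map pw Y) * pw (bs @ v # b # B))) * prod_list (map pw Z)"
    by (subst XYZ(1)) (simp add: ab mult.assoc)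
  ultimately have w: "prod_list (map pw P) = emb q * prod_list (map pw P')"
    by (simp add: P'_eq mult.assoc)
  \<comment> \<open>The additional inversion supplies \<open>- q\<close>; its factor
    \<open>q\<close> is the one lost by the product of weights, and the sign remains.\<close>
  have "signed_weight (swap_tails (\<sigma>, P)) =
    emb ((- q) ^ inversions \<sigma> k) * (emb (- q) * prod_list (map pw P'))"
    unfolding swp signed_weight_def
    by (simp add: inversions_swap[OF \<sigma> st(1,2) adj] power_Suc2 emb_mult emb_uminus mult.assoc del: power_Suc)
  then show ?thesis unfolding signed_weight_def by (simp add: w emb_uminus)
qed

section \<open>Expansion of the minor and cancellation\<close>

definition "all_systems = Sigma {\<sigma>. \<sigma> permutes {..<k}} systems"

lemma finite_systems: "finite (systems \<sigma>)"
proof (rule finite_subset)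
  let ?S = "\<Union>t\<in>{..<k}. {p. is_path E p (r (src t)) (c (snk (\<sigma> t)))}"
  show "systems \<sigma> \<subseteq> {P. set P \<subseteq> ?S \<and> length P = k}"
    by (auto simp: systems_def in_set_conv_nth) blast
  have "finite ?S" using finite_paths[OF subsetD[OF sources_V]] src_mem by auto
  then show "finite {P. set P \<subseteq> ?S \<and> length P = k}" by (rule finite_lists_length_eq)
qed

lemma finite_all_systems: "finite all_systems"
  unfolding all_systems_def by (intro finite_SigmaI finite_systems finite_permutations) auto

lemma qminor_eq: "qminor emb q (path_matrix E pos m r c x xinv) I J = sum signed_weight all_systems"
proof -
  have "prod_list (map (\<lambda>t. path_matrix E pos m r c x xinv (src t) (snk (\<sigma> t))) [0..<k]) =
    (\<Sum>P\<in>systems \<sigma>. prod_list (map pw P))" for \<sigma>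
    unfolding path_matrix_def systems_def
    using finite_paths[OF subsetD[OF sources_V]] src_mem by (subst prod_list_sum) auto
  then show ?thesis
    unfolding qminor_def all_systems_def signed_weight_def Let_def
    by (simp add: sum_distrib_left sum.Sigma[symmetric] finite_systems finite_permutations)
qed

text \<open>\<open>?less\<close> selects one member of each pair, and the two halves have opposite
  sums. Showing only that the whole sum equals its own negative would not suffice in characteristic
  2.\<close>

lemma sum_crossing: "sum signed_weight {(\<sigma>, P) \<in> all_systems. shared P \<noteq> {}} = 0"
proof -
  let ?N = "{(\<sigma>, P) \<in> all_systems. shared P \<noteq> {}}"
  let ?less = "\<lambda>(\<sigma> :: nat \<Rightarrow> nat, P). \<sigma> (Min (crossing P)) < \<sigma> (Max (crossing P))"
  have swap: "swap_tails z \<in> ?N \<and> swap_tails (swap_tails z) = z \<and> (?less (swap_tails z) \<longleftrightarrow> \<not> ?less z)"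
    if "z \<in> ?N" for z
  proof -
    obtain \<sigma> P where z: "z = (\<sigma>, P)" and \<sigma>: "\<sigma> permutes {..<k}" and P: "P \<in> systems \<sigma>" and ne: "shared P \<noteq> {}"
      using \<open>z \<in> ?N\<close> by (auto simp: all_systems_def)
    obtain s t as a A bs b B where st: "s < t" "t < k" "crossing P = {s, t}"
      and ab: "P ! s = as @ pivot P # a # A" "P ! t = bs @ pivot P # b # B"
      using crossing_pair[OF \<sigma> P ne] by metis
    note sw = swap_tails_system[OF \<sigma> P ne st refl ab refl refl]
    have "\<sigma> s \<noteq> \<sigma> t" using permutes_inj[OF \<sigma>] st by (auto simp: inj_def)
    then have "?less (swap_tails z) \<longleftrightarrow> \<not> ?less z" unfolding z sw(1) using sw(5) st by auto
    then show ?thesis unfolding z sw(1) using sw ne by (auto simp: all_systems_def)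
  qed
  have "sum signed_weight {z \<in> ?N. \<not> ?less z} = sum (\<lambda>z. - signed_weight z) {z \<in> ?N. ?less z}"
  proof (rule sum.reindex_bij_witness[where i = swap_tails and j = swap_tails])
    fix z assume z: "z \<in> {z \<in> ?N. \<not> ?less z}"
    note sw = swap[of z]
    show "swap_tails (swap_tails z) = z" "swap_tails z \<in> {z \<in> ?N. ?less z}" using sw z by auto
    obtain \<sigma> P where z': "swap_tails z = (\<sigma>, P)" by fastforce
    have "signed_weight (swap_tails (\<sigma>, P)) = - signed_weight (\<sigma>, P)"
      using sw z z' by (intro swap_tails_weight) (auto simp: all_systems_def)
    then show "- signed_weight (swap_tails z) = signed_weight z"
      using sw z z' by auto
  next
    fix z assume z: "z \<in> {z \<in> ?N. ?less z}"
    show "swap_tails (swap_tails z) = z" "swap_tails z \<in> {z \<in> ?N. \<not> ?less z}" using swap[of z] z by auto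
  qed
  moreover have "sum signed_weight ?N =
    sum signed_weight {z \<in> ?N. ?less z} + sum signed_weight {z \<in> ?N. \<not> ?less z}"
  proof (subst sum.union_disjoint[symmetric])
    have "finite ?N" using finite_subset[OF _ finite_all_systems, of ?N] by auto
    then show "finite {z \<in> ?N. ?less z}" "finite {z \<in> ?N. \<not> ?less z}" by (rule rev_finite_subset, blast)+
    show "{z \<in> ?N. ?less z} \<inter> {z \<in> ?N. \<not> ?less z} = {}" by blast
    show "sum signed_weight ?N = sum signed_weight ({z \<in> ?N. ?less z} \<union> {z \<in> ?N. \<not> ?less z})"
      by (rule arg_cong[where f = "sum signed_weight"]) blast
  qed
  ultimately show ?thesis by (simp only: sum_negf add.right_inverse)
qed

section \<open>Disjoint systems are the flows\<close>

lemma shared_empty_iff: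
  "shared P = {} \<longleftrightarrow> (\<forall>l<k. \<forall>l'<k. l \<noteq> l' \<longrightarrow> set (P ! l) \<inter> set (P ! l') = {})"
  by (auto simp: shared_def)

text \<open>Disjoint paths reach their sinks in the order of their sources, so
  \<open>\<sigma>\<close> is increasing on \<open>{..<k}\<close>; then
  \<open>t \<le> \<sigma> t\<close> for all \<open>t < k\<close>, which for a permutation forces
  equality.\<close>

lemma disjoint_system_id:
  assumes \<sigma>: "\<sigma> permutes {..<k}" and P: "P \<in> systems \<sigma>" and "shared P = {}"
  shows "\<sigma> = id"
proof -
  have less: "\<sigma> s < \<sigma> t" if "s < t" "t < k" for s t
  proof -
    have s: "s < k" using that by auto
    have "snk (\<sigma> s) < snk (\<sigma> t)"
      using assms(3) that s unfolding shared_empty_iff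
      by (intro disjoint_sink_order[OF src_mem[OF s] src_mem[OF that(2)] src_mono[OF that]
            snk_mem'[OF perm_less[OF \<sigma> s]] snk_mem'[OF perm_less[OF \<sigma> that(2)]]
            systemsD(2)[OF P s] systemsD(2)[OF P that(2)]]) auto
    then show ?thesis using snk_less_iff perm_less[OF \<sigma>] s that by blast
  qed
  have "t < k \<Longrightarrow> t \<le> \<sigma> t" for t
  proof (induction t)
    case (Suc t)
    then show ?case using less[of t "Suc t"] by auto
  qed auto
  then show ?thesis using permutes_natset_ge[OF \<sigma>] by auto
qed

text \<open>A flow does not prescribe which sink of \<open>J\<close> a path reaches. Disjointness
  makes the sinks increase with the sources, and since \<open>I\<close> and \<open>J\<close> have
  the same size they are the sorted enumeration of \<open>J\<close>.\<close>

lemma flows_eq: "flows E r c I J = {P \<in> systems id. shared P = {}}"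
proof (intro set_eqI iffI)
  fix P assume "P \<in> flows E r c I J"
  then have len: "length P = k" and ex: "\<And>l. l < k \<Longrightarrow> \<exists>j\<in>J. is_path E (P ! l) (r (src l)) (c j)"
    and disj: "\<And>l l'. l < k \<Longrightarrow> l' < k \<Longrightarrow> l \<noteq> l' \<Longrightarrow> set (P ! l) \<inter> set (P ! l') = {}"
    unfolding flows_def by blast+
  obtain j where j: "\<And>l. l < k \<Longrightarrow> j l \<in> J" "\<And>l. l < k \<Longrightarrow> is_path E (P ! l) (r (src l)) (c (j l))"
    using ex by metis
  have mono: "j l < j l'" if "l < l'" "l' < k" for l l'
  proof -
    have l: "l < k" using that by auto
    show ?thesis
      using disj[OF l that(2)] that j(1)[OF l] j(1)[OF that(2)] IJ(2)
      by (intro disjoint_sink_order[OF src_mem[OF l] src_mem[OF that(2)] src_mono[OF that] _ _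
            j(2)[OF l] j(2)[OF that(2)]]) auto
  qed
  have sorted: "sorted_wrt (<) (map j [0..<k])"
    using mono by (auto simp: sorted_wrt_iff_nth_less)
  have "set (map j [0..<k]) = J"
  proof (rule card_subset_eq[OF finite_IJ(2)])
    show "set (map j [0..<k]) \<subseteq> J" using j(1) by auto
    have "distinct (map j [0..<k])" using sorted strict_sorted_iff by blast
    then show "card (set (map j [0..<k])) = card J" using IJ(3) distinct_card by fastforce
  qed
  then have "map j [0..<k] = sorted_list_of_set J"
    using sorted sorted_list_of_set.idem_if_sorted_distinct[of "map j [0..<k]"] strict_sorted_iff by metis
  then have "j l = snk l" if "l < k" for l using that by (metis add_0 diff_zero length_upt nth_map nth_upt)
  then show "P \<in> {P \<in> systems id. shared P = {}}"
    using len j(2) disj by (auto simp: systems_def shared_empty_iff)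
next
  fix P assume "P \<in> {P \<in> systems id. shared P = {}}"
  then show "P \<in> flows E r c I J"
    using snk_mem by (auto simp: systems_def shared_empty_iff flows_def)
qed

lemma qminor_path_matrix:
  "qminor emb q (path_matrix E pos m r c x xinv) I J =
    (\<Sum>P\<in>flows E r c I J. flow_weight pos m r x xinv P)"
proof -
  let ?N = "{(\<sigma>, P) \<in> all_systems. shared P \<noteq> {}}" and ?D = "{(\<sigma>, P) \<in> all_systems. shared P = {}}"
  have D: "?D = Pair id ` flows E r c I J"
    using disjoint_system_id permutes_id by (auto simp: flows_eq all_systems_def)
  have "{(a, b). a < b \<and> b < k \<and> id b < (id a :: nat)} = {}" by auto
  then have "inversions id k = 0" by (simp only: inversions_def card.empty)
  then have sumD: "sum signed_weight ?D = (\<Sum>P\<in>flows E r c I J. flow_weight pos m r x xinv P)"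
    unfolding D by (subst sum.reindex) (auto simp: inj_on_def signed_weight_def flow_weight_def emb_1)
  have "sum signed_weight all_systems = sum signed_weight (?D \<union> ?N)"
    by (rule arg_cong[where f = "sum signed_weight"]) auto
  also have "\<dots> = sum signed_weight ?D + sum signed_weight ?N"
    by (rule sum.union_disjoint) (auto intro: finite_subset[OF _ finite_all_systems])
  finally show ?thesis unfolding qminor_eq sumD sum_crossing by simp
qed

end

theorem theorem3p1:
  fixes V :: "'v set" and E :: "('v \<times> 'v) set" and pos :: "'v \<Rightarrow> real \<times> real"
    and m n :: nat and r c :: "nat \<Rightarrow> 'v"
    and q :: "'k::field" and emb :: "'k \<Rightarrow> 'a::ring_1"
    and x xinv :: "'v \<Rightarrow> 'a"
    and I J :: "nat set"
  assumes G: "se_graph V E pos m n r c"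
    and q: "q \<noteq> 0"
    \<comment> \<open>'a is a K-algebra via emb\<close>
    and emb_1: "emb 1 = 1"
    and emb_add: "\<And>a b. emb (a + b) = emb a + emb b"
    and emb_mult: "\<And>a b. emb (a * b) = emb a * emb b"
    and emb_central: "\<And>a z. emb a * z = z * emb a"
    \<comment> \<open>x w (w in W) are invertible and satisfy the defining relations of L_G\<close>
    and inv: "\<And>w. w \<in> inner_vertices V m n r c \<Longrightarrow> x w * xinv w = 1 \<and> xinv w * x w = 1"
    and relH: "\<And>u v. u \<in> inner_vertices V m n r c \<Longrightarrow> v \<in> inner_vertices V m n r c \<Longrightarrow>
                 u \<noteq> v \<Longrightarrow> hpath E pos u v \<Longrightarrow> x u * x v = emb q * x v * x u"
    and relV: "\<And>u v. u \<in> inner_vertices V m n r c \<Longrightarrow> v \<in> inner_vertices V m n r c \<Longrightarrow>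
                 u \<noteq> v \<Longrightarrow> vpath E pos u v \<Longrightarrow> x v * x u = emb q * x u * x v"
    and relC: "\<And>u v. u \<in> inner_vertices V m n r c \<Longrightarrow> v \<in> inner_vertices V m n r c \<Longrightarrow>
                 u \<noteq> v \<Longrightarrow> \<not> hpath E pos u v \<Longrightarrow> \<not> hpath E pos v u \<Longrightarrow>
                 \<not> vpath E pos u v \<Longrightarrow> \<not> vpath E pos v u \<Longrightarrow> x u * x v = x v * x u"
    and IJ: "I \<subseteq> {1..m}" "J \<subseteq> {1..n}" "card I = card J"
  shows "qminor emb q (path_matrix E pos m r c x xinv) I J =
         (\<Sum>P\<in>flows E r c I J. flow_weight pos m r x xinv P)"
proof -
  interpret se_minor V E pos m n r c q emb x xinv I J
    by unfold_locales (fact G q emb_1 emb_add emb_mult emb_central inv relH relV relC IJ)+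
  show ?thesis by (rule qminor_path_matrix)
qed

end
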